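(* Let $n\in\mathbb{N}$, let $\widetilde\sigma$ be in $\mathfrak{M}_d(n,\infty)$, let $\{\widetilde{\boldsymbol{p}}_k\}_{k=1}^\infty$ and $\{\widetilde{\boldsymbol{q}}_j\}_{j=1}^{j_0}$ be the sequences of vector polynomials obtained from $\widetilde\sigma$ by the Gram–Schmidt procedure, and let $c_{ik}$ be the coefficients in the expansions $$z\widetilde{\boldsymbol{p}}_k(z)=\sum_{i=1}^{l}c_{ik}\widetilde{\boldsymbol{p}}_i(z)+\sum_{j=1}^{j_0}R_{kj}(z)\widetilde{\boldsymbol{q}}_j(z),\qquad k\in\mathbb{N}$$ ($R_{kj}$ scalar polynomials, $l=l(k)$). Let $\sigma$ be the spectral function of the self-adjoint operator $A$ with matrix representation $\{c_{kl}\}_{k,l=1}^\infty$. Then there exists an $n\times n$ upper triangular matrix $\mathscr{T}$ with real entries and nonzero diagonal entries such that $$\sigma_{\mathscr{T}}:=\mathscr{T}\sigma\mathscr{T}^*$$ coincides with $\widetilde\sigma$.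
   Context: **Function classes.** $\mathfrak{M}(n,\infty)$ is the set of all nondecreasing $n\times n$ matrix-valued functions on $\mathbb{R}$ with an infinite number of growth points such that all the moments $S_k=\int_{\mathbb{R}}t^k\,d\sigma$ ($k\ge 0$) exist and $S_0$ is invertible. $\mathfrak{M}_d(n,\infty)$ is the subset of those functions whose sequence of matrix moments generates a determinate matrix moment problem, i.e. one having only one solution. $L_2(\mathbb{R},\sigma)$ is the usual Hilbert space of (classes of) $\mathbb{C}^n$-valued functions with inner product $\langle f,g\rangle=\int_{\mathbb{R}}\langle f(t),d\sigma(t)g(t)\rangle_{\mathbb{C}^n}$, antilinear in the first argument. **Gram–Schmidt procedure.** An $n$-dimensional vector polynomial is $\boldsymbol{r}(z)=(R_1(z),\dots,R_n(z))^t$ with scalar polynomial entries; its height is $h(\boldsymbol{r}):=\max_{1\le j\le n}\{n\deg R_j+j-1\}$, with $\deg 0:=-\infty$. With $\boldsymbol{e}_1,\dots,\boldsymbol{e}_n$ the canonical basis of $\mathbb{C}^n$, put $\boldsymbol{e}_{nk+i}(z):=z^k\boldsymbol{e}_i$ for $k\ge0$, $1\le i\le n$ (so $h(\boldsymbol{e}_k)=k-1$). Given $\widetilde\sigma\in\mathfrak{M}(n,\infty)$, process $\boldsymbol{e}_1,\boldsymbol{e}_2,\dots$ in order, building a list $\widetilde{\boldsymbol{p}}_1,\widetilde{\boldsymbol{p}}_2,\dots$ of orthonormal vector polynomials and a list $\widetilde{\boldsymbol{q}}_1,\widetilde{\boldsymbol{q}}_2,\dots$ of vector polynomials of zero norm.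 At step $k$: if $k-1=h(\widetilde{\boldsymbol{q}}_i)+nl$ for some already constructed $\widetilde{\boldsymbol{q}}_i$ and some $l\in\mathbb{N}$, skip $\boldsymbol{e}_k$. Otherwise put $\widehat{\boldsymbol{p}}_k:=\boldsymbol{e}_k-\sum_i\langle\widetilde{\boldsymbol{p}}_i,\boldsymbol{e}_k\rangle\widetilde{\boldsymbol{p}}_i$, the sum over all $\widetilde{\boldsymbol{p}}_i$ constructed so far (inner product and norm of $L_2(\mathbb{R},\widetilde\sigma)$); if $\|\widehat{\boldsymbol{p}}_k\|=0$, the next $\widetilde{\boldsymbol{q}}_j$ is $\widehat{\boldsymbol{p}}_k$; otherwise the next $\widetilde{\boldsymbol{p}}_i$ is $\widehat{\boldsymbol{p}}_k/\|\widehat{\boldsymbol{p}}_k\|$. The procedure yields infinitely many $\widetilde{\boldsymbol{p}}_i$ and a number $j_0\le n-1$ of $\widetilde{\boldsymbol{q}}_j$; every vector polynomial is a finite linear combination of the $\widetilde{\boldsymbol{p}}_k$ and the $z^l\widetilde{\boldsymbol{q}}_j$ ($l\ge0$), which gives the expansions in the claim, and $c_{lk}=\langle\widetilde{\boldsymbol{p}}_l,z\widetilde{\boldsymbol{p}}_k\rangle_{L_2(\mathbb{R},\widetilde\sigma)}$. The matrix $\{c_{kl}\}$ is a band matrix ($c_{kl}=0$ for $|k-l|>n$). **Operator and its spectral function.** $A$ is the minimal closed symmetric operator in a separable Hilbert space whose matrix representation with respect to an orthonormal basis $\{\delta_k\}_{k=1}^\infty$ is $\{c_{kl}\}_{k,l=1}^\infty$,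 i.e. the closure of the operator defined on the linear span of $\{\delta_k\}$ by $\delta_l\mapsto\sum_k c_{kl}\delta_k$. The definition of $\sigma$ and $\sigma_{\mathscr{T}}$ presupposes that $A$ is self-adjoint. With $E_A$ the resolution of the identity of $A$, $$\sigma(t):=\{\langle\delta_i,E_A(t)\delta_j\rangle\}_{i,j=1}^n.$$
   Formalization: As stated the claim fails for n ≥ 2. What is proved is that the measure equals T*σT with T upper triangular (instead of TσT* ), with real nonzero diagonal; all entries of T are real whenever the zeroth moment S_0 is real, since a non-real S_0 admits no real T. *)

theory Defs
  imports
    "HOL-Analysis.Lebesgue_Measure"
    "HOL-Analysis.Bochner_Integration"
    "HOL-Computational_Algebra.Polynomial"
    "Jordan_Normal_Form.Matrix"
    "Jordan_Normal_Form.Schur_Decomposition"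
begin

text \<open>
  Indices are 0-based throughout: component \<open>j < n\<close> of a vector is the component \<open>j + 1\<close> of
  the usual numbering, and likewise for sequences of polynomials and basis vectors.
\<close>

section \<open>Stieltjes integrals and matrix-valued distribution functions\<close>

text \<open>
  The integral of \<open>f\<close> against \<open>dF\<close> for complex \<open>F\<close> of bounded variation, through a decomposition
  \<open>F = (P 0 - P 2) + \<i> (P 1 - P 3)\<close> into nondecreasing right-continuous parts, each of which
  integrates \<open>f\<close> absolutely. The value does not depend on the decomposition.
\<close>

definition has_stieltjes_integral ::
  "(real \<Rightarrow> complex) \<Rightarrow> (real \<Rightarrow> complex) \<Rightarrow> complex \<Rightarrow> bool" where
  "has_stieltjes_integral f F I \<longleftrightarrow>
     (\<exists>P :: nat \<Rightarrow> real \<Rightarrow> real.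
        (\<forall>m<4. mono (P m) \<and> (\<forall>t. continuous (at_right t) (P m)) \<and>
               integrable (interval_measure (P m)) f) \<and>
        (\<forall>t. F t = (\<Sum>m<4. \<i> ^ m * complex_of_real (P m t))) \<and>
        I = (\<Sum>m<4. \<i> ^ m * integral\<^sup>L (interval_measure (P m)) f))"

definition stieltjes_integral :: "(real \<Rightarrow> complex) \<Rightarrow> (real \<Rightarrow> complex) \<Rightarrow> complex" where
  "stieltjes_integral f F = (THE I. has_stieltjes_integral f F I)"

text \<open>Over \<open>\<complex>\<close> this includes that the matrix is Hermitian.\<close>

definition positive_semidefinite :: "nat \<Rightarrow> complex mat \<Rightarrow> bool" where
  "positive_semidefinite n M \<longleftrightarrow>
     M \<in> carrier_mat n n \<and>
     (\<forall>v \<in> carrier_vec n. (M *\<^sub>v v) \<bullet>c v \<in> \<real> \<and> 0 \<le> Re ((M *\<^sub>v v) \<bullet>c v))"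

text \<open>
  A nondecreasing function matters only through its differential. It is normalised to be
  right-continuous and to vanish at \<open>-\<infinity>\<close>, so that functions with the same differential are equal;
  resolutions of the identity below are normalised in the same way.
\<close>

definition nondecreasing_matrix_function :: "nat \<Rightarrow> (real \<Rightarrow> complex mat) \<Rightarrow> bool" where
  "nondecreasing_matrix_function n \<sigma> \<longleftrightarrow>
     (\<forall>t. \<sigma> t \<in> carrier_mat n n) \<and>
     (\<forall>s t. s \<le> t \<longrightarrow> positive_semidefinite n (\<sigma> t - \<sigma> s)) \<and>
     (\<forall>i<n. \<forall>j<n. \<forall>t. continuous (at_right t) (\<lambda>t. \<sigma> t $$ (i, j))) \<and>
     (\<forall>i<n. \<forall>j<n. ((\<lambda>t. \<sigma> t $$ (i, j)) \<longlongrightarrow> 0) at_bot)"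

definition growth_points :: "(real \<Rightarrow> complex mat) \<Rightarrow> real set" where
  "growth_points \<sigma> = {t. \<forall>\<epsilon>>0. \<sigma> (t - \<epsilon>) \<noteq> \<sigma> (t + \<epsilon>)}"

definition all_moments_exist :: "nat \<Rightarrow> (real \<Rightarrow> complex mat) \<Rightarrow> bool" where
  "all_moments_exist n \<sigma> \<longleftrightarrow>
     (\<forall>k. \<forall>i<n. \<forall>j<n. \<exists>I.
        has_stieltjes_integral (\<lambda>t. complex_of_real (t ^ k)) (\<lambda>t. \<sigma> t $$ (i, j)) I)"

definition matrix_moment :: "nat \<Rightarrow> (real \<Rightarrow> complex mat) \<Rightarrow> nat \<Rightarrow> complex mat" where
  "matrix_moment n \<sigma> k =
     mat n n (\<lambda>(i, j).
       stieltjes_integral (\<lambda>t. complex_of_real (t ^ k)) (\<lambda>t. \<sigma> t $$ (i, j)))"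

definition \<MM> :: "nat \<Rightarrow> (real \<Rightarrow> complex mat) set" where
  "\<MM> n = {\<sigma>. nondecreasing_matrix_function n \<sigma> \<and> infinite (growth_points \<sigma>) \<and>
               all_moments_exist n \<sigma> \<and> invertible_mat (matrix_moment n \<sigma> 0)}"

definition \<MM>\<^sub>d :: "nat \<Rightarrow> (real \<Rightarrow> complex mat) set" where
  "\<MM>\<^sub>d n = {\<sigma> \<in> \<MM> n. \<forall>\<tau>.
      nondecreasing_matrix_function n \<tau> \<and> all_moments_exist n \<tau> \<and>
      (\<forall>k. matrix_moment n \<tau> k = matrix_moment n \<sigma> k) \<longrightarrow> \<tau> = \<sigma>}"

section \<open>Vector polynomials and the Gram--Schmidt procedure\<close>

text \<open>An \<open>n\<close>-dimensional vector polynomial is an element of \<open>carrier_vec n\<close>.\<close>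

type_synonym vpoly = "complex poly vec"

text \<open>
  Zero components have degree \<open>-\<infinity>\<close> and do not contribute. The height is only used for nonzero
  vector polynomials.
\<close>

definition height :: "nat \<Rightarrow> vpoly \<Rightarrow> nat" where
  "height n r = Max {n * degree (vec_index r j) + j | j. j < n \<and> vec_index r j \<noteq> 0}"

text \<open>\<open>e n (n * k + i) = z ^ k e\<^sub>i\<close> for \<open>i < n\<close>.\<close>

definition basis_vpoly :: "nat \<Rightarrow> nat \<Rightarrow> vpoly" where
  "basis_vpoly n k = vec n (\<lambda>j. if j = k mod n then monom 1 (k div n) else 0)"

definition L2_inner :: "nat \<Rightarrow> (real \<Rightarrow> complex mat) \<Rightarrow> vpoly \<Rightarrow> vpoly \<Rightarrow> complex" where
  "L2_inner n \<sigma> f g =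
     (\<Sum>i<n. \<Sum>j<n. stieltjes_integral
        (\<lambda>t. cnj (poly (vec_index f i) (complex_of_real t)) *
             poly (vec_index g j) (complex_of_real t))
        (\<lambda>t. \<sigma> t $$ (i, j)))"

definition L2_norm :: "nat \<Rightarrow> (real \<Rightarrow> complex mat) \<Rightarrow> vpoly \<Rightarrow> real" where
  "L2_norm n \<sigma> f = sqrt (Re (L2_inner n \<sigma> f f))"

definition gs_residual ::
  "nat \<Rightarrow> (real \<Rightarrow> complex mat) \<Rightarrow> vpoly list \<Rightarrow> nat \<Rightarrow> vpoly" where
  "gs_residual n \<sigma> ps k =
     vec n (\<lambda>m. vec_index (basis_vpoly n k) m -
       (\<Sum>i<length ps. smult (L2_inner n \<sigma> (ps ! i) (basis_vpoly n k)) (vec_index (ps ! i) m)))"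

text \<open>
  \<open>gs_lists n \<sigma> k\<close> is the pair of lists (orthonormal polynomials, zero-norm polynomials) built from
  the first \<open>k\<close> elements \<open>basis_vpoly n 0, \<dots>, basis_vpoly n (k - 1)\<close>.
\<close>

primrec gs_lists :: "nat \<Rightarrow> (real \<Rightarrow> complex mat) \<Rightarrow> nat \<Rightarrow> vpoly list \<times> vpoly list" where
  "gs_lists n \<sigma> 0 = ([], [])"
| "gs_lists n \<sigma> (Suc k) =
     (let (ps, qs) = gs_lists n \<sigma> k; r = gs_residual n \<sigma> ps k in
      if \<exists>q \<in> set qs. \<exists>l. k = height n q + n * l then (ps, qs)
      else if L2_norm n \<sigma> r = 0 then (ps, qs @ [r])
      else (ps @ [[:complex_of_real (1 / L2_norm n \<sigma> r):] \<cdot>\<^sub>v r], qs))"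

definition gram_schmidt_output ::
  "nat \<Rightarrow> (real \<Rightarrow> complex mat) \<Rightarrow> (nat \<Rightarrow> vpoly) \<Rightarrow> nat \<Rightarrow> (nat \<Rightarrow> vpoly) \<Rightarrow> bool" where
  "gram_schmidt_output n \<sigma> p j\<^sub>0 q \<longleftrightarrow>
     (\<forall>i. \<exists>k. i < length (fst (gs_lists n \<sigma> k)) \<and> p i = fst (gs_lists n \<sigma> k) ! i) \<and>
     (\<forall>j<j\<^sub>0. \<exists>k. j < length (snd (gs_lists n \<sigma> k)) \<and> q j = snd (gs_lists n \<sigma> k) ! j) \<and>
     (\<forall>k. length (snd (gs_lists n \<sigma> k)) \<le> j\<^sub>0)"

section \<open>Complex Hilbert spaces, self-adjoint operators, spectral resolutions\<close>

text \<open>\<open>cinner\<close> is antilinear in its first argument.\<close>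

class complex_hilbert = real_inner + complete_space +
  fixes scaleC :: "complex \<Rightarrow> 'a \<Rightarrow> 'a" (infixr "*\<^sub>C" 75)
    and cinner :: "'a \<Rightarrow> 'a \<Rightarrow> complex"
  assumes scaleC_add_right: "scaleC a (x + y) = scaleC a x + scaleC a y"
    and scaleC_add_left: "scaleC (a + b) x = scaleC a x + scaleC b x"
    and scaleC_scaleC: "scaleC a (scaleC b x) = scaleC (a * b) x"
    and scaleC_of_real: "scaleC (complex_of_real r) x = scaleR r x"
    and cinner_add_right: "cinner x (y + z) = cinner x y + cinner x z"
    and cinner_scaleC_right: "cinner x (scaleC a y) = a * cinner x y"
    and cinner_commute: "cinner x y = cnj (cinner y x)"
    and Re_cinner: "Re (cinner x y) = inner x y"

definition orthonormal_basis :: "(nat \<Rightarrow> 'h::complex_hilbert) \<Rightarrow> bool" where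
  "orthonormal_basis \<delta> \<longleftrightarrow>
     (\<forall>k l. cinner (\<delta> k) (\<delta> l) = (if k = l then 1 else 0)) \<and>
     closure {\<Sum>l<N. a l *\<^sub>C \<delta> l | N a. True} = UNIV"

text \<open>
  Unbounded operators are represented by their graphs. The series over \<open>k\<close> below is a finite sum
  for a band matrix.
\<close>

definition minimal_closed_operator ::
  "(nat \<Rightarrow> nat \<Rightarrow> complex) \<Rightarrow> (nat \<Rightarrow> 'h::complex_hilbert) \<Rightarrow> ('h \<times> 'h) set" where
  "minimal_closed_operator c \<delta> =
     closure {(\<Sum>l<N. a l *\<^sub>C \<delta> l, \<Sum>l<N. a l *\<^sub>C (\<Sum>k. c k l *\<^sub>C \<delta> k)) | N a. True}"

definition adjoint_operator :: "('h::complex_hilbert \<times> 'h) set \<Rightarrow> ('h \<times> 'h) set" where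
  "adjoint_operator A = {(x, y). \<forall>(u, v) \<in> A. cinner x v = cinner y u}"

definition self_adjoint :: "('h::complex_hilbert \<times> 'h) set \<Rightarrow> bool" where
  "self_adjoint A \<longleftrightarrow> closure (Domain A) = UNIV \<and> adjoint_operator A = A"

text \<open>
  The first two conditions say that each \<open>E t\<close> is an orthogonal projection; linearity and
  boundedness follow from symmetry on the whole space.
\<close>

definition resolution_of_identity :: "(real \<Rightarrow> 'h::complex_hilbert \<Rightarrow> 'h) \<Rightarrow> bool" where
  "resolution_of_identity E \<longleftrightarrow>
     (\<forall>t x. E t (E t x) = E t x) \<and>
     (\<forall>t x y. cinner (E t x) y = cinner x (E t y)) \<and>
     (\<forall>s t x. E s (E t x) = E (min s t) x) \<and>
     (\<forall>t x. ((\<lambda>s. E s x) \<longlongrightarrow> E t x) (at_right t)) \<and>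
     (\<forall>x. ((\<lambda>t. E t x) \<longlongrightarrow> 0) at_bot) \<and>
     (\<forall>x. ((\<lambda>t. E t x) \<longlongrightarrow> x) at_top)"

text \<open>The graph of \<open>\<integral> t dE(t)\<close>, with domain the \<open>x\<close> for which \<open>\<integral> t\<^sup>2 d\<langle>x, E(t) x\<rangle>\<close> is finite.\<close>

definition spectral_operator :: "(real \<Rightarrow> 'h::complex_hilbert \<Rightarrow> 'h) \<Rightarrow> ('h \<times> 'h) set" where
  "spectral_operator E =
     {(x, y). integrable (interval_measure (\<lambda>t. Re (cinner x (E t x)))) (\<lambda>t. t\<^sup>2) \<and>
        (\<forall>z. has_stieltjes_integral complex_of_real (\<lambda>t. cinner z (E t x)) (cinner z y))}"

definition resolution_of_identity_of ::
  "(real \<Rightarrow> 'h::complex_hilbert \<Rightarrow> 'h) \<Rightarrow> ('h \<times> 'h) set \<Rightarrow> bool" where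
  "resolution_of_identity_of E A \<longleftrightarrow> resolution_of_identity E \<and> A = spectral_operator E"

text \<open>
  If \<open>P\<close> is the upper triangular matrix with columns \<open>p 0, \<dots>, p (n - 1)\<close>, the spectral function of
  the operator built from the orthonormal polynomials of \<open>\<sigma>'\<close> is \<open>P\<^sup>* \<sigma>' P\<close>. Hence the congruence by the
  upper triangular \<open>T = P\<^sup>-\<^sup>1\<close> that recovers \<open>\<sigma>'\<close> is \<open>T\<^sup>* \<sigma> T\<close>. (With \<open>T \<sigma> T\<^sup>*\<close> the triangular
  factor has to be lower triangular.) Letting \<open>t \<rightarrow> \<infinity>\<close> gives \<open>S\<^sub>0 = T\<^sup>* T\<close>, so \<open>T\<close> can be real
  only if \<open>S\<^sub>0\<close> is.
\<close>

definition spectral_function ::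
  "nat \<Rightarrow> (nat \<Rightarrow> 'h::complex_hilbert) \<Rightarrow> (real \<Rightarrow> 'h \<Rightarrow> 'h) \<Rightarrow> real \<Rightarrow> complex mat" where
  "spectral_function n \<delta> E t = mat n n (\<lambda>(i, j). cinner (\<delta> i) (E t (\<delta> j)))"

end

theory Submission
  imports Defs "HOL-Probability.Distribution_Functions"
begin

text \<open>
  Since \<open>S\<^sub>0\<close> is invertible, the first \<open>n\<close> steps of the Gram--Schmidt procedure produce constant vectors
  \<open>p 0, \<dots>, p (n - 1)\<close>, and the \<open>T\<close> of the theorem expresses the canonical basis vectors through them.
  Modulo polynomials of zero norm, sending \<open>p k\<close> to \<open>\<delta> k\<close> is isometric and turns multiplication by \<open>z\<close>
  into \<open>A\<close>, so the moments \<open>\<langle>e\<^sub>i, z\<^sup>k e\<^sub>j\<rangle>\<close> of \<open>\<sigma>'\<close> equal \<open>\<langle>X\<^sub>i, A\<^sup>k X\<^sub>j\<rangle>\<close>, where \<open>X\<^sub>j\<close> is the image of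
  \<open>e\<^sub>j\<close>. By the spectral representation of \<open>A\<close> these are the moments of \<open>\<langle>X\<^sub>i, E(t) X\<^sub>j\<rangle>\<close>, the entries of
  \<open>T\<^sup>* \<sigma>(t) T\<close>, and determinacy identifies the two functions.
\<close>

section \<open>Distribution functions and Stieltjes integrals\<close>

text \<open>The obstacle is that integrals and operator are given only weakly.
  \<open>has_stieltjes_integral\<close> asserts that some decomposition exists, possibly another one
  for each integrand, so linearity and positivity of the inner product must first be recovered from
  one decomposition dominated by diagonal entries. Positivity is what allows zero-norm polynomials
  to be discarded, by a Cauchy-Schwarz argument. On the operator side,
  \<open>spectral_operator\<close> describes one pair (x, y) at a time and offers no functional
  calculus. Powers are therefore replaced by chains w 0, w 1, ... whose consecutive members lie in
  the graph, and all moments come from two facts: the scalar spectral measure of w 1 is t^2 times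
  that of w 0, and the graph is symmetric. Self-adjointness enters there, since a graph equal to its
  adjoint is symmetric and linear. Finally, determinacy only compares nondecreasing functions
  possessing all moments, so the transformed spectral function must be shown to be one; polarization
  supplies nondecreasing parts in the pattern of the definition of the integral.\<close>

definition distribution_function :: "(real \<Rightarrow> real) \<Rightarrow> bool" where
  "distribution_function P \<longleftrightarrow> mono P \<and> (\<forall>t. continuous (at_right t) P)"

lemma emeasure_distribution_function:
  assumes "distribution_function P" "a \<le> b"
  shows "emeasure (interval_measure P) {a<..b} = ennreal (P b - P a)"
  using assms by (intro emeasure_interval_measure_Ioc) (auto simp: distribution_function_def mono_def)

lemma interval_measure_eqI:
  assumes P: "distribution_function P" and M: "sets M = sets borel"
    and eq: "\<And>a b. a \<le> b \<Longrightarrow> emeasure M {a<..b} = ennreal (P b - P a)"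
  shows "interval_measure P = M"
proof (rule measure_eqI_generator_eq[where \<Omega>=UNIV])
  fix X assume "X \<in> range (\<lambda>(a, b). {a<..b::real})"
  then obtain a b where "X = {a<..b}" by auto
  then show "emeasure (interval_measure P) X = emeasure M X"
    by (cases "a \<le> b") (simp_all add: eq emeasure_distribution_function[OF P])
next
  show "(\<Union>i. {- real (i::nat)<..real i}) = UNIV"
    by (rule UN_Ioc_eq_UNIV)
qed (auto simp: M borel_sigma_sets_Ioc Int_stable_def emeasure_distribution_function[OF P])

section \<open>Additivity of the measure in its distribution function\<close>

lemma distribution_function_add:
  assumes "distribution_function P" "distribution_function Q"
  shows "distribution_function (\<lambda>t. P t + Q t)"
  using assms unfolding distribution_function_def
  by (auto intro!: continuous_add monoI add_mono dest: monoD)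

text \<open>The sum of the two set functions is countably additive, hence a measure, and on
  half-open intervals it has the increments of P + Q; \<open>interval_measure_eqI\<close> then
  identifies it.\<close>

lemma emeasure_interval_measure_add:
  assumes P: "distribution_function P" and Q: "distribution_function Q" and A: "A \<in> sets borel"
  shows "emeasure (interval_measure (\<lambda>t. P t + Q t)) A =
    emeasure (interval_measure P) A + emeasure (interval_measure Q) A"
proof -
  let ?\<mu> = "\<lambda>A. emeasure (interval_measure P) A + emeasure (interval_measure Q) A"
  let ?N = "measure_of UNIV (sets borel) ?\<mu>"
  have N: "emeasure ?N A = ?\<mu> A" if "A \<in> sets borel" for A
  proof (rule emeasure_measure_of_sigma[OF _ _ _ that])
    show "sigma_algebra UNIV (sets (borel :: real measure))"
      by (metis sets.sigma_algebra_axioms space_borel)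
    show "positive (sets borel) ?\<mu>" by (simp add: positive_def)
    show "countably_additive (sets borel) ?\<mu>"
    proof (rule countably_additiveI)
      fix A :: "nat \<Rightarrow> real set"
      assume A: "range A \<subseteq> sets borel" "disjoint_family A"
      show "(\<Sum>i. ?\<mu> (A i)) = ?\<mu> (\<Union> (range A))"
        using A by (simp add: suminf_add[symmetric] suminf_emeasure)
    qed
  qed
  have "interval_measure (\<lambda>t. P t + Q t) = ?N"
  proof (rule interval_measure_eqI[OF distribution_function_add[OF P Q]])
    show "sets ?N = sets borel"
      by (metis sets.sets_measure_of_eq space_borel)
    fix a b :: real assume "a \<le> b"
    then have "P a \<le> P b" "Q a \<le> Q b"
      using P Q by (auto simp: distribution_function_def mono_def)
    then show "emeasure ?N {a<..b} = ennreal (P b + Q b - (P a + Q a))"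
      using \<open>a \<le> b\<close> P Q
      by (simp add: N emeasure_distribution_function ennreal_plus[symmetric] del: ennreal_plus)
  qed
  then show ?thesis using N[OF A] by simp
qed

lemma nn_integral_interval_measure_add:
  assumes P: "distribution_function P" and Q: "distribution_function Q"
    and f: "f \<in> borel_measurable borel"
  shows "(\<integral>\<^sup>+t. f t \<partial>interval_measure (\<lambda>t. P t + Q t)) =
    (\<integral>\<^sup>+t. f t \<partial>interval_measure P) + (\<integral>\<^sup>+t. f t \<partial>interval_measure Q)"
  using f
proof (induction rule: borel_measurable_induct)
  case (cong f g)
  then show ?case by (simp add: fun_eq_iff)
next
  case (set A)
  then show ?case by (simp add: emeasure_interval_measure_add[OF P Q])
next
  case (mult u c)
  then show ?case by (simp add: nn_integral_cmult distrib_left)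
next
  case (add u v)
  then show ?case by (simp add: nn_integral_add add_ac)
next
  case (seq U)
  have *: "(\<integral>\<^sup>+t. (SUP i. U i) t \<partial>interval_measure R) = (SUP i. \<integral>\<^sup>+t. U i t \<partial>interval_measure R)" for R
    using seq by (simp add: nn_integral_monotone_convergence_SUP image_comp)
  have inc: "incseq (\<lambda>i. \<integral>\<^sup>+t. U i t \<partial>interval_measure R)" for R
    using seq(3) by (auto simp: incseq_def le_fun_def intro!: nn_integral_mono)
  show ?case unfolding * by (simp add: seq.IH ennreal_SUP_add[OF inc inc])
qed

lemma
  fixes f :: "real \<Rightarrow> 'b :: {banach, second_countable_topology}"
  assumes P: "distribution_function P" and Q: "distribution_function Q"
  shows integrable_interval_measure_add:
    "integrable (interval_measure (\<lambda>t. P t + Q t)) f \<longleftrightarrow>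
      integrable (interval_measure P) f \<and> integrable (interval_measure Q) f"
  by (auto simp: integrable_iff_bounded nn_integral_interval_measure_add[OF P Q])

lemma integral_interval_measure_add:
  fixes f :: "real \<Rightarrow> complex"
  assumes P: "distribution_function P" and Q: "distribution_function Q"
    and f: "integrable (interval_measure P) f" "integrable (interval_measure Q) f"
  shows "integral\<^sup>L (interval_measure (\<lambda>t. P t + Q t)) f =
    integral\<^sup>L (interval_measure P) f + integral\<^sup>L (interval_measure Q) f"
proof -
  let ?R = "\<lambda>t. P t + Q t"
  have real: "integral\<^sup>L (interval_measure ?R) g =
      integral\<^sup>L (interval_measure P) g + integral\<^sup>L (interval_measure Q) g"
    if g: "integrable (interval_measure P) g" "integrable (interval_measure Q) g" for g :: "real \<Rightarrow> real"
  proof -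
    have gR: "integrable (interval_measure ?R) g"
      using g by (simp add: integrable_interval_measure_add[OF P Q])
    have m: "g \<in> borel_measurable borel" using g by auto
    \<comment> \<open>\<open>enn2real\<close> is additive only on finite values, so the integrals of
      positive and negative part must be finite for P and Q separately.\<close>
    have fin: "(\<integral>\<^sup>+t. ennreal (g t) \<partial>interval_measure F) \<noteq> \<infinity>"
              "(\<integral>\<^sup>+t. ennreal (- g t) \<partial>interval_measure F) \<noteq> \<infinity>"
      if "F = P \<or> F = Q" for F
      using that g by (auto simp: real_integrable_def)
    have add: "enn2real (\<integral>\<^sup>+t. ennreal (h t) \<partial>interval_measure ?R) =
        enn2real (\<integral>\<^sup>+t. ennreal (h t) \<partial>interval_measure P) + enn2real (\<integral>\<^sup>+t. ennreal (h t) \<partial>interval_measure Q)"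
      if "h = g \<or> h = (\<lambda>t. - g t)" for h
    proof -
      have "(\<lambda>t. ennreal (h t)) \<in> borel_measurable borel" using that m by auto
      from nn_integral_interval_measure_add[OF P Q this] show ?thesis
        using that fin[of P] fin[of Q] by (auto simp: enn2real_plus less_top[symmetric])
    qed
    show ?thesis
      unfolding real_lebesgue_integral_def[OF gR] real_lebesgue_integral_def[OF g(1)]
        real_lebesgue_integral_def[OF g(2)]
      using add[of g] add[of "\<lambda>t. - g t"] by simp
  qed
  have fR: "integrable (interval_measure ?R) f"
    using f by (simp add: integrable_interval_measure_add[OF P Q])
  show ?thesis
    using real[of "\<lambda>t. Re (f t)"] real[of "\<lambda>t. Im (f t)"] f fR
    by (intro complex_eqI) simp_all
qed

section \<open>Independence of the Stieltjes integral from the decomposition\<close>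

lemma sum_lessThan_4: "(\<Sum>m<4::nat. f m) = f 0 + f 1 + f 2 + (f 3 :: 'a :: comm_monoid_add)"
  by (simp add: eval_nat_numeral)

lemma all_less_4: "(\<forall>m<4. Q m) \<longleftrightarrow> Q 0 \<and> Q 1 \<and> Q 2 \<and> Q (3::nat)"
  by (auto simp: eval_nat_numeral less_Suc_eq)

lemma has_stieltjes_integral_iff:
  "has_stieltjes_integral f F I \<longleftrightarrow>
     (\<exists>P. (\<forall>m<4. distribution_function (P m) \<and> integrable (interval_measure (P m)) f) \<and>
        (\<forall>t. F t = (\<Sum>m<4. \<i> ^ m * complex_of_real (P m t))) \<and>
        I = (\<Sum>m<4. \<i> ^ m * integral\<^sup>L (interval_measure (P m)) f))"
  by (simp only: has_stieltjes_integral_def distribution_function_def conj_assoc)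

text \<open>A difference of nondecreasing functions has no \<open>interval_measure\<close>, so the
  identity P 0 - P 2 = Q 0 - Q 2 of the real parts is rearranged to P 0 + Q 2 = Q 0 + P 2, and
  likewise for the indices 1 and 3. Both sides are then distribution functions, and additivity of
  the integral in them applies.\<close>

lemma has_stieltjes_integral_unique:
  assumes "has_stieltjes_integral f F I" "has_stieltjes_integral f F J"
  shows "I = J"
proof -
  obtain P where P: "\<forall>m<4. distribution_function (P m) \<and> integrable (interval_measure (P m)) f"
      "\<And>t. F t = (\<Sum>m<4. \<i> ^ m * complex_of_real (P m t))"
      "I = (\<Sum>m<4. \<i> ^ m * integral\<^sup>L (interval_measure (P m)) f)"
    using assms(1) unfolding has_stieltjes_integral_iff by blast
  obtain Q where Q: "\<forall>m<4. distribution_function (Q m) \<and> integrable (interval_measure (Q m)) f"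
      "\<And>t. F t = (\<Sum>m<4. \<i> ^ m * complex_of_real (Q m t))"
      "J = (\<Sum>m<4. \<i> ^ m * integral\<^sup>L (interval_measure (Q m)) f)"
    using assms(2) unfolding has_stieltjes_integral_iff by blast
  have "P 0 t + Q 2 t = Q 0 t + P 2 t" "P 1 t + Q 3 t = Q 1 t + P 3 t" for t
  proof -
    have "(\<Sum>m<4. \<i> ^ m * complex_of_real (P m t)) = (\<Sum>m<4. \<i> ^ m * complex_of_real (Q m t))"
      using P(2)[of t] Q(2)[of t] by simp
    then show "P 0 t + Q 2 t = Q 0 t + P 2 t" "P 1 t + Q 3 t = Q 1 t + P 3 t"
      by (simp_all add: sum_lessThan_4 complex_eq_iff power3_eq_cube)
  qed
  then have eq: "(\<lambda>t. P 0 t + Q 2 t) = (\<lambda>t. Q 0 t + P 2 t)" "(\<lambda>t. P 1 t + Q 3 t) = (\<lambda>t. Q 1 t + P 3 t)"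
    by auto
  have i0: "integral\<^sup>L (interval_measure (P 0)) f + integral\<^sup>L (interval_measure (Q 2)) f =
        integral\<^sup>L (interval_measure (Q 0)) f + integral\<^sup>L (interval_measure (P 2)) f"
    using P(1) Q(1) unfolding all_less_4
    by (simp add: integral_interval_measure_add[symmetric] eq(1))
  have i1: "integral\<^sup>L (interval_measure (P 1)) f + integral\<^sup>L (interval_measure (Q 3)) f =
        integral\<^sup>L (interval_measure (Q 1)) f + integral\<^sup>L (interval_measure (P 3)) f"
    using P(1) Q(1) unfolding all_less_4
    by (simp add: integral_interval_measure_add[symmetric] eq(2)[simplified])
  have "I = (a - c) + \<i> * (b - d)" "J = (a' - c') + \<i> * (b' - d')"
    if "a = integral\<^sup>L (interval_measure (P 0)) f" "b = integral\<^sup>L (interval_measure (P 1)) f"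
       "c = integral\<^sup>L (interval_measure (P 2)) f" "d = integral\<^sup>L (interval_measure (P 3)) f"
       "a' = integral\<^sup>L (interval_measure (Q 0)) f" "b' = integral\<^sup>L (interval_measure (Q 1)) f"
       "c' = integral\<^sup>L (interval_measure (Q 2)) f" "d' = integral\<^sup>L (interval_measure (Q 3)) f"
    for a b c d a' b' c' d'
    unfolding P(3) Q(3) that sum_lessThan_4 by (simp_all add: power3_eq_cube algebra_simps)
  note IJ = this[OF refl refl refl refl refl refl refl refl]
  have "a - c = a' - c'" if "a + c' = a' + c" for a a' c c' :: complex
    using that by (simp add: algebra_simps)
  from this[OF i0] this[OF i1] show ?thesis
    unfolding IJ by (simp only:)
qed

lemma stieltjes_integral_eqI: "has_stieltjes_integral f F I \<Longrightarrow> stieltjes_integral f F = I"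
  unfolding stieltjes_integral_def using has_stieltjes_integral_unique by blast

lemma has_stieltjes_integralI:
  assumes "\<forall>m<4. distribution_function (P m) \<and> integrable (interval_measure (P m)) f"
    and "\<And>t. F t = (\<Sum>m<4. \<i> ^ m * complex_of_real (P m t))"
  shows "has_stieltjes_integral f F (\<Sum>m<4. \<i> ^ m * integral\<^sup>L (interval_measure (P m)) f)"
  using assms unfolding has_stieltjes_integral_iff by blast

lemma distribution_function_const: "distribution_function (\<lambda>t. c)"
  by (simp add: distribution_function_def mono_def)

lemma interval_measure_const: "interval_measure (\<lambda>t. c) = null_measure borel"
  by (rule interval_measure_eqI[OF distribution_function_const]) auto

lemma integrable_null_measure: "f \<in> borel_measurable borel \<Longrightarrow> integrable (null_measure borel) f"
  for f :: "real \<Rightarrow> 'b :: {banach, second_countable_topology}"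
  by (simp add: integrable_iff_bounded)

lemma has_stieltjes_integral_diff:
  assumes "distribution_function P" "distribution_function Q"
    and "integrable (interval_measure P) f" "integrable (interval_measure Q) f"
  shows "has_stieltjes_integral f (\<lambda>t. complex_of_real (P t - Q t))
    (integral\<^sup>L (interval_measure P) f - integral\<^sup>L (interval_measure Q) f)"
proof -
  have m: "f \<in> borel_measurable borel" using assms(3) by auto
  show ?thesis
    \<comment> \<open>Only the coefficients i^0 = 1 and i^2 = -1 are used; the other two parts are
      constantly 0 and contribute the null measure.\<close>
    using has_stieltjes_integralI[of "\<lambda>m. if m = 0 then P else if m = 2 then Q else (\<lambda>_. 0)" f
        "\<lambda>t. complex_of_real (P t - Q t)"] assms
    unfolding all_less_4 sum_lessThan_4
    by (simp add: distribution_function_const interval_measure_const integrable_null_measure[OF m])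
qed

section \<open>Polynomials in the \<open>L\<^sub>2\<close> space of a matrix measure\<close>

text \<open>Functions on the real line rather than polynomials, because the integrands of the inner
  product contain complex conjugates. For real t, conjugation only conjugates the coefficients, so
  the class is closed under it.\<close>

definition polynomial_fun :: "(real \<Rightarrow> complex) \<Rightarrow> bool" where
  "polynomial_fun f \<longleftrightarrow> (\<exists>p. \<forall>t. f t = poly p (complex_of_real t))"

lemma polynomial_fun_poly: "polynomial_fun (\<lambda>t. poly p (complex_of_real t))"
  by (auto simp: polynomial_fun_def)

lemma polynomial_fun_const: "polynomial_fun (\<lambda>t. c)"
  unfolding polynomial_fun_def by (rule exI[of _ "[:c:]"]) simp

lemma polynomial_fun_of_real: "polynomial_fun complex_of_real"
  unfolding polynomial_fun_def by (rule exI[of _ "[:0, 1:]"]) simp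

lemma polynomial_fun_add: "polynomial_fun f \<Longrightarrow> polynomial_fun g \<Longrightarrow> polynomial_fun (\<lambda>t. f t + g t)"
  unfolding polynomial_fun_def by (metis poly_add)

lemma polynomial_fun_mult: "polynomial_fun f \<Longrightarrow> polynomial_fun g \<Longrightarrow> polynomial_fun (\<lambda>t. f t * g t)"
  unfolding polynomial_fun_def by (metis poly_mult)

lemma polynomial_fun_sum:
  "(\<And>i. i \<in> S \<Longrightarrow> polynomial_fun (f i)) \<Longrightarrow> polynomial_fun (\<lambda>t. \<Sum>i\<in>S. f i t)"
  by (induction S rule: infinite_finite_induct) (auto intro: polynomial_fun_const polynomial_fun_add)

lemma polynomial_fun_power: "polynomial_fun (\<lambda>t. complex_of_real t ^ k)"
  by (induction k) (auto intro: polynomial_fun_const polynomial_fun_mult polynomial_fun_of_real)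

lemma polynomial_fun_cnj:
  assumes "polynomial_fun f" shows "polynomial_fun (\<lambda>t. cnj (f t))"
proof -
  obtain p where p: "\<And>t. f t = poly p (complex_of_real t)"
    using assms by (auto simp: polynomial_fun_def)
  have eq: "(\<lambda>t. cnj (f t)) = (\<lambda>t. \<Sum>i\<le>degree p. cnj (coeff p i) * complex_of_real t ^ i)"
    by (simp add: p poly_altdef)
  show ?thesis unfolding eq
    by (intro polynomial_fun_sum polynomial_fun_mult polynomial_fun_const polynomial_fun_power)
qed

lemmas polynomial_fun_intros = polynomial_fun_poly polynomial_fun_const polynomial_fun_of_real
  polynomial_fun_add polynomial_fun_mult polynomial_fun_sum polynomial_fun_power polynomial_fun_cnj

section \<open>Positive semidefinite matrices\<close>

lemma cscalar_prod_mult_mat_vec: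
  assumes "M \<in> carrier_mat n n"
  shows "(M *\<^sub>v vec n u) \<bullet>c vec n u = (\<Sum>i<n. \<Sum>j<n. cnj (u i) * u j * M $$ (i, j))"
proof -
  have "(M *\<^sub>v vec n u) \<bullet>c vec n u = (\<Sum>i<n. (\<Sum>j<n. M $$ (i, j) * u j) * cnj (u i))"
    using assms by (simp add: scalar_prod_def lessThan_atLeast0)
  then show ?thesis
    by (simp add: sum_distrib_right sum_distrib_left mult_ac)
qed

lemma positive_semidefinite_sum:
  assumes "positive_semidefinite n M"
  shows "Im (\<Sum>i<n. \<Sum>j<n. cnj (u i) * u j * M $$ (i, j)) = 0"
    and "0 \<le> Re (\<Sum>i<n. \<Sum>j<n. cnj (u i) * u j * M $$ (i, j))"
  using assms cscalar_prod_mult_mat_vec[of M n u] unfolding positive_semidefinite_def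
  by (auto simp: complex_is_Real_iff dest!: bspec[of _ _ "vec n u"])

text \<open>It suffices to test the quadratic form on e_i + c e_j: c = 0 gives the diagonal, reality
  for c = 1 and c = i makes the entries (i, j) and (j, i) conjugate to each other, and nonnegativity
  for c = 1, -1, i, -i then bounds the real and imaginary part of the entry (i, j).\<close>

lemma positive_semidefinite_entries:
  assumes M: "positive_semidefinite n M" and ij: "i < n" "j < n"
  shows "Im (M $$ (i, i)) = 0" "0 \<le> Re (M $$ (i, i))"
    and "\<bar>Re (M $$ (i, j))\<bar> \<le> Re (M $$ (i, i)) + Re (M $$ (j, j))"
    and "\<bar>Im (M $$ (i, j))\<bar> \<le> Re (M $$ (i, i)) + Re (M $$ (j, j))"
proof -
  have form: "Im (M $$ (i, i) + c * M $$ (i, j) + cnj c * M $$ (j, i) + cnj c * c * M $$ (j, j)) = 0 \<and>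
      0 \<le> Re (M $$ (i, i) + c * M $$ (i, j) + cnj c * M $$ (j, i) + cnj c * c * M $$ (j, j))"
    if ij: "i < n" "j < n" for c i j
  proof -
    let ?u = "\<lambda>k. (if k = i then 1 else 0) + (if k = j then c else 0)"
    have inner: "(\<Sum>k<n. ?u k * X k) = X i + c * X j" for X :: "nat \<Rightarrow> complex"
      using ij by (simp add: distrib_right sum.distrib if_distrib[of "\<lambda>x. x * _"] cong: if_cong)
    have outer: "(\<Sum>k<n. cnj (?u k) * X k) = X i + cnj c * X j" for X :: "nat \<Rightarrow> complex"
      using ij by (simp add: distrib_right sum.distrib if_distrib[of "\<lambda>x. x * _"] if_distrib[of cnj] cong: if_cong)
    have "(\<Sum>k<n. \<Sum>l<n. cnj (?u k) * ?u l * M $$ (k, l)) =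
        M $$ (i, i) + c * M $$ (i, j) + cnj c * M $$ (j, i) + cnj c * c * M $$ (j, j)"
      unfolding mult.assoc sum_distrib_left[symmetric] inner outer by (simp add: algebra_simps)
    then show ?thesis
      using positive_semidefinite_sum[OF M, of ?u] by simp
  qed
  show d: "Im (M $$ (i, i)) = 0" "0 \<le> Re (M $$ (i, i))"
    using form[OF ij, of 0] by auto
  have d': "Im (M $$ (j, j)) = 0" "0 \<le> Re (M $$ (j, j))"
    using form[of j i 0] ij by auto
  note f = form[OF ij, of 1] form[OF ij, of "-1"] form[OF ij, of \<i>] form[OF ij, of "-\<i>"]
  show "\<bar>Re (M $$ (i, j))\<bar> \<le> Re (M $$ (i, i)) + Re (M $$ (j, j))"
    "\<bar>Im (M $$ (i, j))\<bar> \<le> Re (M $$ (i, i)) + Re (M $$ (j, j))"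
    using f d d' by (auto simp: abs_le_iff)
qed

section \<open>A common decomposition of the entries, and the inner product it defines\<close>

locale matrix_distribution =
  fixes n :: nat and \<sigma> :: "real \<Rightarrow> complex mat"
  assumes nondecreasing: "nondecreasing_matrix_function n \<sigma>"
    and moments: "all_moments_exist n \<sigma>"
begin

lemma carrier_values: "\<sigma> t \<in> carrier_mat n n"
  using nondecreasing unfolding nondecreasing_matrix_function_def by blast

lemma increment_semidefinite: "s \<le> t \<Longrightarrow> positive_semidefinite n (\<sigma> t - \<sigma> s)"
  using nondecreasing unfolding nondecreasing_matrix_function_def by blast

lemma increment_entry:
  "i < n \<Longrightarrow> j < n \<Longrightarrow> (\<sigma> t - \<sigma> s) $$ (i, j) = \<sigma> t $$ (i, j) - \<sigma> s $$ (i, j)"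
  using carrier_values[of s] carrier_values[of t] by simp

definition diag_sum :: "nat \<Rightarrow> nat \<Rightarrow> real \<Rightarrow> real" where
  "diag_sum i j t = Re (\<sigma> t $$ (i, i)) + Re (\<sigma> t $$ (j, j))"

text \<open>
  A decomposition of the entry \<open>(i, j)\<close> whose parts are all dominated by twice the sum of the diagonal
  entries \<open>(i, i)\<close> and \<open>(j, j)\<close>. One decomposition thus serves all moments at once, whereas
  \<^const>\<open>all_moments_exist\<close> allows it to depend on the exponent.
\<close>

definition part :: "nat \<Rightarrow> nat \<Rightarrow> nat \<Rightarrow> real \<Rightarrow> real" where
  "part i j m t = diag_sum i j t -
     (if m = 2 then Re (\<sigma> t $$ (i, j)) else if m = 3 then Im (\<sigma> t $$ (i, j)) else 0)"

text \<open>The summand \<open>diag_sum\<close> common to all four parts cancels because 1 + i + i^2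
  + i^3 = 0. What survives is -i^2 Re - i^3 Im, which is Re + i Im of the entry.\<close>

lemma entry_eq_parts:
  assumes "i < n" "j < n"
  shows "\<sigma> t $$ (i, j) = (\<Sum>m<4. \<i> ^ m * complex_of_real (part i j m t))"
  unfolding sum_lessThan_4 part_def by (simp add: complex_eq_iff power3_eq_cube)

lemma right_continuous_entry:
  "i < n \<Longrightarrow> j < n \<Longrightarrow> continuous (at_right t) (\<lambda>t. \<sigma> t $$ (i, j))"
  using nondecreasing unfolding nondecreasing_matrix_function_def by blast

lemma distribution_function_diag: "i < n \<Longrightarrow> distribution_function (\<lambda>t. Re (\<sigma> t $$ (i, i)))"
  unfolding distribution_function_def
  using positive_semidefinite_entries(2)[OF increment_semidefinite]
  by (auto intro!: monoI continuous_Re right_continuous_entry simp: increment_entry)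

lemma increment_bounds:
  assumes "i < n" "j < n" "s \<le> t"
  shows "\<bar>Re (\<sigma> t $$ (i, j)) - Re (\<sigma> s $$ (i, j))\<bar> \<le> diag_sum i j t - diag_sum i j s"
    and "\<bar>Im (\<sigma> t $$ (i, j)) - Im (\<sigma> s $$ (i, j))\<bar> \<le> diag_sum i j t - diag_sum i j s"
  using positive_semidefinite_entries(3,4)[OF increment_semidefinite[OF assms(3)] assms(1,2)] assms
  by (auto simp: diag_sum_def increment_entry)

lemma distribution_function_diag_sum: "i < n \<Longrightarrow> j < n \<Longrightarrow> distribution_function (diag_sum i j)"
  unfolding diag_sum_def by (intro distribution_function_add distribution_function_diag)

text \<open>The second claim expresses domination: the measures of \<open>part i j m\<close> and of
  this complement add up to that of twice \<open>diag_sum i j\<close>, so integrability against the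
  diagonal entries passes to every part.\<close>

lemma distribution_function_part:
  assumes "i < n" "j < n"
  shows "distribution_function (part i j m)"
    and "distribution_function (\<lambda>t. 2 * diag_sum i j t - part i j m t)"
proof -
  have W: "mono (diag_sum i j)" "continuous (at_right t) (diag_sum i j)" for t
    using distribution_function_diag_sum[OF assms] by (auto simp: distribution_function_def)
  have m: "\<bar>Re (\<sigma> t $$ (i, j)) - Re (\<sigma> s $$ (i, j))\<bar> \<le> diag_sum i j t - diag_sum i j s"
     "\<bar>Im (\<sigma> t $$ (i, j)) - Im (\<sigma> s $$ (i, j))\<bar> \<le> diag_sum i j t - diag_sum i j s"
     "diag_sum i j s \<le> diag_sum i j t" if "s \<le> t" for s t
    using increment_bounds[OF assms that] W(1) that by (auto dest: monoD)
  have "part i j m s \<le> part i j m t"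
    "2 * diag_sum i j s - part i j m s \<le> 2 * diag_sum i j t - part i j m t" if "s \<le> t" for s t
    unfolding part_def using m[OF that] by (auto simp: abs_le_iff)
  moreover have "continuous (at_right t) (part i j m)" for t
  proof -
    consider "m = 2" | "m = 3" | "m \<noteq> 2" "m \<noteq> 3" by blast
    then show ?thesis
      using continuous_diff[OF W(2) continuous_Re[OF right_continuous_entry[OF assms]], of t]
        continuous_diff[OF W(2) continuous_Im[OF right_continuous_entry[OF assms]], of t] W(2)[of t]
      by cases (simp_all add: part_def[abs_def])
  qed
  ultimately show "distribution_function (part i j m)"
    and "distribution_function (\<lambda>t. 2 * diag_sum i j t - part i j m t)"
    unfolding distribution_function_def by (auto intro!: monoI continuous_intros W(2))
qed

text \<open>The decomposition P supplied by the moment assumption is arbitrary, but its real part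
  says that P 0 is the diagonal entry plus P 2. The measure of the diagonal entry is therefore below
  that of P 0, against which the power is integrable.\<close>

lemma integrable_power_diag:
  assumes i: "i < n"
  shows "integrable (interval_measure (\<lambda>t. Re (\<sigma> t $$ (i, i)))) (\<lambda>t. complex_of_real t ^ k)"
proof -
  obtain I where "has_stieltjes_integral (\<lambda>t. complex_of_real (t ^ k)) (\<lambda>t. \<sigma> t $$ (i, i)) I"
    using moments i unfolding all_moments_exist_def by blast
  then obtain P where P: "\<forall>m<4. distribution_function (P m) \<and>
        integrable (interval_measure (P m)) (\<lambda>t. complex_of_real (t ^ k))"
      "\<And>t. \<sigma> t $$ (i, i) = (\<Sum>m<4. \<i> ^ m * complex_of_real (P m t))"
    unfolding has_stieltjes_integral_iff by blast
  have "Re (\<sigma> t $$ (i, i)) + P 2 t = P 0 t" for t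
    unfolding P(2) sum_lessThan_4 by (simp add: power3_eq_cube)
  then have "P 0 = (\<lambda>t. Re (\<sigma> t $$ (i, i)) + P 2 t)" by auto
  then show ?thesis
    using P(1) integrable_interval_measure_add[OF distribution_function_diag[OF i], of "P 2" "\<lambda>t. complex_of_real (t ^ k)"]
    unfolding all_less_4 by simp
qed

lemma integrable_power_part:
  assumes ij: "i < n" "j < n"
  shows "integrable (interval_measure (part i j m)) (\<lambda>t. complex_of_real t ^ k)"
proof -
  note W = distribution_function_diag_sum[OF ij]
  have "integrable (interval_measure (diag_sum i j)) (\<lambda>t. complex_of_real t ^ k)"
    unfolding diag_sum_def
    by (subst integrable_interval_measure_add)
      (auto intro: distribution_function_diag integrable_power_diag ij)
  then have "integrable (interval_measure (\<lambda>t. diag_sum i j t + diag_sum i j t)) (\<lambda>t. complex_of_real t ^ k)"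
    by (simp only: integrable_interval_measure_add[OF W W])
  moreover have "(\<lambda>t. diag_sum i j t + diag_sum i j t) = (\<lambda>t. part i j m t + (2 * diag_sum i j t - part i j m t))"
    by auto
  ultimately have "integrable (interval_measure (\<lambda>t. part i j m t + (2 * diag_sum i j t - part i j m t)))
      (\<lambda>t. complex_of_real t ^ k)"
    by (simp only:)
  then show ?thesis
    unfolding integrable_interval_measure_add[OF distribution_function_part[OF ij]] ..
qed

lemma integrable_polynomial_fun_part:
  assumes ij: "i < n" "j < n" and f: "polynomial_fun f"
  shows "integrable (interval_measure (part i j m)) f"
proof -
  obtain p where p: "\<And>t. f t = poly p (complex_of_real t)"
    using f by (auto simp: polynomial_fun_def)
  have eq: "f = (\<lambda>t. \<Sum>k\<le>degree p. coeff p k * complex_of_real t ^ k)"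
    by (simp add: p poly_altdef fun_eq_iff)
  show ?thesis
    unfolding eq by (auto intro!: Bochner_Integration.integrable_sum integrable_mult_right integrable_power_part ij)
qed

definition entry_integral :: "nat \<Rightarrow> nat \<Rightarrow> (real \<Rightarrow> complex) \<Rightarrow> complex" where
  "entry_integral i j f = (\<Sum>m<4. \<i> ^ m * integral\<^sup>L (interval_measure (part i j m)) f)"

lemma stieltjes_integral_entry:
  assumes "i < n" "j < n" "polynomial_fun f"
  shows "stieltjes_integral f (\<lambda>t. \<sigma> t $$ (i, j)) = entry_integral i j f"
  unfolding entry_integral_def
  by (intro stieltjes_integral_eqI has_stieltjes_integralI)
    (auto intro: distribution_function_part integrable_polynomial_fun_part assms entry_eq_parts)

lemma entry_integral_add:
  assumes "i < n" "j < n" "polynomial_fun f" "polynomial_fun g"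
  shows "entry_integral i j (\<lambda>t. f t + g t) = entry_integral i j f + entry_integral i j g"
  unfolding entry_integral_def
  by (simp add: integrable_polynomial_fun_part assms distrib_left sum.distrib)

lemma entry_integral_cmult:
  "entry_integral i j (\<lambda>t. c * f t) = c * entry_integral i j f"
  unfolding entry_integral_def by (simp add: sum_distrib_left mult_ac)

text \<open>The inner product of \<open>L\<^sub>2(\<real>, \<sigma>)\<close>, on \<open>n\<close>-tuples of polynomial functions.\<close>

definition form :: "(nat \<Rightarrow> real \<Rightarrow> complex) \<Rightarrow> (nat \<Rightarrow> real \<Rightarrow> complex) \<Rightarrow> complex" where
  "form f g = (\<Sum>i<n. \<Sum>j<n. entry_integral i j (\<lambda>t. cnj (f i t) * g j t))"

lemma form_cong:
  "(\<And>i t. i < n \<Longrightarrow> f i t = f' i t) \<Longrightarrow> (\<And>i t. i < n \<Longrightarrow> g i t = g' i t) \<Longrightarrow> form f g = form f' g'"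
  by (simp add: form_def)

lemma L2_inner_eq_form:
  "L2_inner n \<sigma> f g = form (\<lambda>i t. poly (f $ i) (complex_of_real t)) (\<lambda>i t. poly (g $ i) (complex_of_real t))"
  unfolding L2_inner_def form_def
  by (intro sum.cong refl stieltjes_integral_entry polynomial_fun_intros) auto

lemma form_add_right:
  assumes "\<And>i. i < n \<Longrightarrow> polynomial_fun (f i)" "\<And>i. i < n \<Longrightarrow> polynomial_fun (g i)"
    "\<And>i. i < n \<Longrightarrow> polynomial_fun (h i)"
  shows "form f (\<lambda>i t. g i t + h i t) = form f g + form f h"
  unfolding form_def
  by (simp add: distrib_left entry_integral_add polynomial_fun_intros assms sum.distrib)

lemma form_add_left:
  assumes "\<And>i. i < n \<Longrightarrow> polynomial_fun (f i)" "\<And>i. i < n \<Longrightarrow> polynomial_fun (g i)"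
    "\<And>i. i < n \<Longrightarrow> polynomial_fun (h i)"
  shows "form (\<lambda>i t. f i t + g i t) h = form f h + form g h"
  unfolding form_def
  by (simp add: distrib_right entry_integral_add polynomial_fun_intros assms sum.distrib)

lemma form_cmult_right: "form f (\<lambda>i t. c * g i t) = c * form f g"
  unfolding form_def by (simp add: sum_distrib_left mult.left_commute entry_integral_cmult[symmetric])

lemma form_cmult_left: "form (\<lambda>i t. c * f i t) g = cnj c * form f g"
  unfolding form_def by (simp add: sum_distrib_left mult.assoc entry_integral_cmult[symmetric])

lemma form_mult_shift: "form f (\<lambda>i t. r t * g i t) = form (\<lambda>i t. cnj (r t) * f i t) g"
  unfolding form_def by (simp add: mult_ac)

end

section \<open>Positivity of the inner product by step functions\<close>

lemma polynomial_fun_locally_dominated: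
  assumes "polynomial_fun h"
  obtains w :: "real \<Rightarrow> real" where "polynomial_fun (\<lambda>t. complex_of_real (w t))"
    "\<And>s t. \<bar>s - t\<bar> \<le> 1 \<Longrightarrow> cmod (h s) \<le> w t"
proof -
  obtain p where p: "\<And>t. h t = poly p (complex_of_real t)"
    using assms by (auto simp: polynomial_fun_def)
  \<comment> \<open>A majorant that is again polynomial, hence integrable against every
    \<open>part\<close>. It bounds h on the unit neighbourhood of t, where the sample points of the
    step functions lie; 2 * t^2 + 2 comes from |s| <= |t| + 1 and 2 * |t| <= t^2 + 1.\<close>
  let ?w = "\<lambda>t. \<Sum>k\<le>degree p. cmod (coeff p k) * (2 * t\<^sup>2 + 2) ^ k"
  have w: "(\<lambda>t. complex_of_real (?w t)) = (\<lambda>t. \<Sum>k\<le>degree p. complex_of_real (cmod (coeff p k)) *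
      poly ([:2, 0, 2:] ^ k) (complex_of_real t))"
    by (auto simp: power2_eq_square algebra_simps)
  show thesis
  proof (rule that[of ?w])
    show "polynomial_fun (\<lambda>t. complex_of_real (?w t))"
      unfolding w by (intro polynomial_fun_intros)
    fix s t :: real assume "\<bar>s - t\<bar> \<le> 1"
    moreover have "0 \<le> (\<bar>t\<bar> - 1)\<^sup>2" by simp
    then have "2 * \<bar>t\<bar> \<le> t\<^sup>2 + 1" by (simp add: power2_diff)
    moreover have "0 \<le> t\<^sup>2" by simp
    ultimately have s: "\<bar>s\<bar> \<le> 2 * t\<^sup>2 + 2" by linarith
    have "cmod (h s) \<le> (\<Sum>k\<le>degree p. cmod (coeff p k) * \<bar>s\<bar> ^ k)"
      unfolding p poly_altdef by (intro sum_norm_le) (simp add: norm_mult norm_power)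
    also have "\<dots> \<le> ?w t"
      using s by (intro sum_mono mult_left_mono power_mono) auto
    finally show "cmod (h s) \<le> ?w t" .
  qed
qed

lemma polynomial_fun_isCont: "polynomial_fun h \<Longrightarrow> isCont h t"
  unfolding polynomial_fun_def by (auto simp: fun_eq_iff[symmetric] intro!: continuous_intros)

lemma polynomial_fun_measurable: "polynomial_fun h \<Longrightarrow> h \<in> borel_measurable borel"
  by (intro borel_measurable_continuous_onI continuous_at_imp_continuous_on ballI polynomial_fun_isCont)

text \<open>The cells have width 1 / N and indices up to N^2 in absolute value, so refining the mesh
  also exhausts the real line.\<close>

definition step_cells :: "nat \<Rightarrow> int set" where
  "step_cells N = {- (int N * int N)..int N * int N}"

definition step_approx :: "nat \<Rightarrow> (real \<Rightarrow> complex) \<Rightarrow> real \<Rightarrow> complex" where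
  "step_approx N h t = (\<Sum>k\<in>step_cells N.
     indicator {real_of_int (k - 1) / real N<..real_of_int k / real N} t *\<^sub>R h (real_of_int k / real N))"

lemma step_approx_eq:
  assumes "N > 0"
  shows "step_approx N h t = (if \<lceil>t * real N\<rceil> \<in> step_cells N then h (real_of_int \<lceil>t * real N\<rceil> / real N) else 0)"
proof -
  have "(t \<in> {real_of_int (k - 1) / real N<..real_of_int k / real N}) \<longleftrightarrow> k = \<lceil>t * real N\<rceil>" for k
    using assms by (auto simp: divide_simps ceiling_eq_iff eq_commute[of k])
  then have "step_approx N h t = (\<Sum>k\<in>step_cells N. if k = \<lceil>t * real N\<rceil> then h (real_of_int k / real N) else 0)"
    unfolding step_approx_def by (intro sum.cong) (auto simp: indicator_def)
  then show ?thesis by (simp add: sum.delta step_cells_def)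
qed

lemma ceiling_grid:
  assumes "N > 0"
  shows "\<bar>real_of_int \<lceil>t * real N\<rceil> / real N - t\<bar> \<le> 1 / real N"
proof -
  have "\<bar>real_of_int \<lceil>t * real N\<rceil> - t * real N\<bar> \<le> 1"
    by linarith
  moreover have "real_of_int \<lceil>t * real N\<rceil> / real N - t = (real_of_int \<lceil>t * real N\<rceil> - t * real N) / real N"
    using assms by (simp add: field_simps)
  ultimately show ?thesis using assms by (simp add: divide_right_mono)
qed

lemma step_approx_tendsto:
  assumes "isCont h t"
  shows "(\<lambda>N. step_approx (Suc N) h t) \<longlonglongrightarrow> h t"
proof -
  let ?r = "\<lambda>N. real_of_int \<lceil>t * real (Suc N)\<rceil> / real (Suc N)"
  have "(\<lambda>N. ?r N - t) \<longlonglongrightarrow> 0"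
  proof (rule Lim_null_comparison)
    show "\<forall>\<^sub>F N in sequentially. norm (?r N - t) \<le> 1 / real (Suc N)"
      unfolding real_norm_def by (intro always_eventually allI ceiling_grid) simp
    show "(\<lambda>N. 1 / real (Suc N)) \<longlonglongrightarrow> 0"
      by (rule LIMSEQ_Suc[OF lim_1_over_n])
  qed
  then have "?r \<longlonglongrightarrow> t" by (simp add: LIM_zero_iff)
  then have *: "(\<lambda>N. h (?r N)) \<longlonglongrightarrow> h t"
    by (rule isCont_tendsto_compose[OF assms])
  have "\<forall>\<^sub>F N in sequentially. h (?r N) = step_approx (Suc N) h t"
    using eventually_ge_at_top[of "nat \<lceil>\<bar>t\<bar>\<rceil>"]
  proof eventually_elim
    case (elim N)
    define d where "d = Suc N"
    have "\<bar>t\<bar> \<le> real d" using elim unfolding d_def by linarith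
    then have "\<bar>t * real d\<bar> \<le> real d * real d"
      unfolding abs_mult by (intro mult_mono) auto
    then have "- (int d * int d) \<le> \<lceil>t * real d\<rceil>" "\<lceil>t * real d\<rceil> \<le> int d * int d"
      by (simp_all add: ceiling_le_iff le_ceiling_iff abs_le_iff)
    then show ?case
      unfolding step_approx_eq[OF zero_less_Suc] step_cells_def d_def by simp
  qed
  then show ?thesis using * by (rule Lim_transform_eventually[rotated])
qed

context matrix_distribution
begin

lemma integral_step_approx:
  assumes "i < n" "j < n"
  shows "integral\<^sup>L (interval_measure (part i j m)) (step_approx N h) =
    (\<Sum>k\<in>step_cells N. (part i j m (real_of_int k / real N) - part i j m (real_of_int (k - 1) / real N)) *\<^sub>R
       h (real_of_int k / real N))"
proof -
  let ?M = "interval_measure (part i j m)"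
  note D = distribution_function_part(1)[OF assms, of m]
  have cell: "real_of_int (k - 1) / real N \<le> real_of_int k / real N" for k
    by (intro divide_right_mono) auto
  have me: "measure ?M {real_of_int (k - 1) / real N<..real_of_int k / real N} =
      part i j m (real_of_int k / real N) - part i j m (real_of_int (k - 1) / real N)" for k
    using D by (intro measure_interval_measure_Ioc cell) (auto simp: distribution_function_def mono_def)
  have "has_bochner_integral ?M (step_approx N h) (\<Sum>k\<in>step_cells N.
      measure ?M {real_of_int (k - 1) / real N<..real_of_int k / real N} *\<^sub>R h (real_of_int k / real N))"
    unfolding step_approx_def[abs_def]
    by (intro has_bochner_integral_sum has_bochner_integral_indicator)
      (simp_all only: emeasure_distribution_function[OF D cell] ennreal_less_top infinity_ennreal_def sets_interval_measure greaterThanAtMost_borel)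
  then show ?thesis unfolding me by (rule has_bochner_integral_integral_eq)
qed

lemma integral_step_approx_tendsto:
  assumes ij: "i < n" "j < n" and h: "polynomial_fun h"
  shows "(\<lambda>N. integral\<^sup>L (interval_measure (part i j m)) (step_approx (Suc N) h)) \<longlonglongrightarrow>
     integral\<^sup>L (interval_measure (part i j m)) h"
proof -
  let ?M = "interval_measure (part i j m)"
  obtain w where w: "polynomial_fun (\<lambda>t. complex_of_real (w t))"
    "\<And>s t. \<bar>s - t\<bar> \<le> 1 \<Longrightarrow> cmod (h s) \<le> w t"
    using polynomial_fun_locally_dominated[OF h] by blast
  show ?thesis
  proof (rule integral_dominated_convergence[where w=w])
    show "integrable ?M w"
      using integrable_Re[OF integrable_polynomial_fun_part[OF ij w(1), of m]] by simp
    show "h \<in> borel_measurable ?M" using polynomial_fun_measurable[OF h] by simp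
    show "step_approx (Suc N) h \<in> borel_measurable ?M" for N
      unfolding step_approx_def[abs_def] by measurable
    show "AE t in ?M. (\<lambda>N. step_approx (Suc N) h t) \<longlonglongrightarrow> h t"
      by (intro AE_I2 step_approx_tendsto polynomial_fun_isCont h)
    show "AE t in ?M. norm (step_approx (Suc N) h t) \<le> w t" for N
    proof (rule AE_I2)
      fix t
      have "0 \<le> w t" using w(2)[of t t] norm_ge_zero[of "h t"] by linarith
      moreover have "1 / real (Suc N) \<le> 1" by simp
      then have "cmod (h (real_of_int \<lceil>t * real (Suc N)\<rceil> / real (Suc N))) \<le> w t"
        using ceiling_grid[of "Suc N" t] by (intro w(2)) linarith
      ultimately show "norm (step_approx (Suc N) h t) \<le> w t"
        by (simp add: step_approx_eq)
    qed
  qed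
qed

text \<open>For step functions the form is a sum of values of the positive semidefinite increments of \<open>\<sigma>\<close>.\<close>

lemma form_self_nonneg:
  assumes f: "\<And>i. i < n \<Longrightarrow> polynomial_fun (f i)"
  shows "Im (form f f) = 0" "0 \<le> Re (form f f)"
proof -
  let ?h = "\<lambda>i j t. cnj (f i t) * f j t"
  define S where "S N = (\<Sum>i<n. \<Sum>j<n. \<Sum>m<4. \<i> ^ m *
      integral\<^sup>L (interval_measure (part i j m)) (step_approx (Suc N) (?h i j)))" for N
  have lim: "S \<longlonglongrightarrow> form f f"
    unfolding form_def entry_integral_def S_def
    by (intro tendsto_intros integral_step_approx_tendsto polynomial_fun_intros f) auto
  have S: "S N = (\<Sum>k\<in>step_cells (Suc N). \<Sum>i<n. \<Sum>j<n. cnj (f i (real_of_int k / real (Suc N))) *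
     f j (real_of_int k / real (Suc N)) *
     (\<sigma> (real_of_int k / real (Suc N)) - \<sigma> (real_of_int (k - 1) / real (Suc N))) $$ (i, j))" for N
  proof -
    let ?b = "\<lambda>k. real_of_int k / real (Suc N)"
    have "S N = (\<Sum>i<n. \<Sum>j<n. \<Sum>k\<in>step_cells (Suc N). ?h i j (?b k) *
        (\<Sum>m<4. \<i> ^ m * complex_of_real (part i j m (?b k)) - \<i> ^ m * complex_of_real (part i j m (?b (k - 1)))))"
      unfolding S_def sum_distrib_left
      by (intro sum.cong refl, subst sum.swap)
        (simp add: integral_step_approx sum_distrib_left scaleR_conv_of_real algebra_simps)
    also have "\<dots> = (\<Sum>i<n. \<Sum>j<n. \<Sum>k\<in>step_cells (Suc N). ?h i j (?b k) *
        (\<sigma> (?b k) - \<sigma> (?b (k - 1))) $$ (i, j))"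
      by (intro sum.cong refl) (simp add: increment_entry entry_eq_parts sum_subtractf)
    also have "\<dots> = (\<Sum>i<n. \<Sum>k\<in>step_cells (Suc N). \<Sum>j<n. ?h i j (?b k) *
        (\<sigma> (?b k) - \<sigma> (?b (k - 1))) $$ (i, j))"
      by (intro sum.cong refl, rule sum.swap)
    also have "\<dots> = (\<Sum>k\<in>step_cells (Suc N). \<Sum>i<n. \<Sum>j<n. ?h i j (?b k) *
        (\<sigma> (?b k) - \<sigma> (?b (k - 1))) $$ (i, j))"
      by (rule sum.swap)
    finally show ?thesis .
  qed
  have psd: "positive_semidefinite n (\<sigma> (real_of_int k / real (Suc N)) - \<sigma> (real_of_int (k - 1) / real (Suc N)))" for k N
    by (intro increment_semidefinite divide_right_mono) auto
  have "Im (S N) = 0" for N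
    unfolding S Im_sum[of _ "step_cells (Suc N)"]
    by (intro sum.neutral ballI positive_semidefinite_sum(1)[OF psd])
  moreover have "0 \<le> Re (S N)" for N
    unfolding S Re_sum[of _ "step_cells (Suc N)"]
    by (intro sum_nonneg positive_semidefinite_sum(2)[OF psd])
  moreover note tendsto_Im[OF lim] tendsto_Re[OF lim]
  ultimately show "Im (form f f) = 0" "0 \<le> Re (form f f)"
    by (auto simp: LIMSEQ_const_iff intro!: LIMSEQ_le_const)
qed

text \<open>The form is real on f + c g for every c; c = 1 settles the imaginary part and c = i the
  real part.\<close>

lemma form_commute:
  assumes f: "\<And>i. i < n \<Longrightarrow> polynomial_fun (f i)" and g: "\<And>i. i < n \<Longrightarrow> polynomial_fun (g i)"
  shows "form f g = cnj (form g f)"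
proof -
  have expand: "form (\<lambda>i t. f i t + c * g i t) (\<lambda>i t. f i t + c * g i t) =
      form f f + c * form f g + (cnj c * form g f + cnj c * c * form g g)" for c
  proof -
    have cg: "\<And>i. i < n \<Longrightarrow> polynomial_fun (\<lambda>t. c * g i t)"
      by (intro polynomial_fun_intros g)
    have fg: "\<And>i. i < n \<Longrightarrow> polynomial_fun (\<lambda>t. f i t + c * g i t)"
      by (intro polynomial_fun_intros f g)
    show ?thesis
      by (simp add: form_add_left[OF f cg fg] form_add_right[OF f f cg] form_add_right[OF g f cg]
          form_cmult_left form_cmult_right algebra_simps)
  qed
  have "Im (form (\<lambda>i t. f i t + c * g i t) (\<lambda>i t. f i t + c * g i t)) = 0" for c
    by (intro form_self_nonneg polynomial_fun_intros f g)
  from this[of 1] this[of \<i>] show ?thesis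
    unfolding expand using form_self_nonneg(1)[OF f] form_self_nonneg(1)[OF g]
    by (simp add: complex_eq_iff)
qed

text \<open>The degenerate case of Cauchy-Schwarz. As q has zero norm, the square of g + c q
  contains no quadratic term in c, and it stays nonnegative for all complex c only if the linear
  term vanishes.\<close>

lemma form_null:
  assumes q: "\<And>i. i < n \<Longrightarrow> polynomial_fun (q i)" and g: "\<And>i. i < n \<Longrightarrow> polynomial_fun (g i)"
    and null: "form q q = 0"
  shows "form q g = 0" "form g q = 0"
proof -
  have expand: "form (\<lambda>i t. g i t + c * q i t) (\<lambda>i t. g i t + c * q i t) =
      form g g + (c * form g q + cnj (c * form g q))" for c
  proof -
    have cq: "\<And>i. i < n \<Longrightarrow> polynomial_fun (\<lambda>t. c * q i t)"
      by (intro polynomial_fun_intros q)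
    have gq: "\<And>i. i < n \<Longrightarrow> polynomial_fun (\<lambda>t. g i t + c * q i t)"
      by (intro polynomial_fun_intros g q)
    show ?thesis
      by (simp add: form_add_left[OF g cq gq] form_add_right[OF g g cq] form_add_right[OF q g cq]
          form_cmult_left form_cmult_right null form_commute[OF q g])
  qed
  have nonneg: "0 \<le> Re (form g g) + 2 * Re (c * form g q)" for c
  proof -
    have "0 \<le> Re (form (\<lambda>i t. g i t + c * q i t) (\<lambda>i t. g i t + c * q i t))"
      by (intro form_self_nonneg(2) polynomial_fun_intros g q)
    then show ?thesis unfolding expand by simp
  qed
  show "form g q = 0"
  proof (rule ccontr)
    assume nz: "form g q \<noteq> 0"
    \<comment> \<open>With this c the expression in \<open>nonneg\<close> becomes - <g, g> - 2,
      which is negative.\<close>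
    let ?c = "- complex_of_real (Re (form g g) + 1) / form g q"
    have "0 \<le> Re (form g g)" by (rule form_self_nonneg(2)[OF g])
    moreover have "?c * form g q = - complex_of_real (Re (form g g) + 1)" using nz by simp
    ultimately show False using nonneg[of ?c] by simp
  qed
  then show "form q g = 0" using form_commute[OF q g] by simp
qed

end

section \<open>Spectral moments of a self-adjoint operator\<close>

lemma scaleC_zero_left: "0 *\<^sub>C (x :: 'h :: complex_hilbert) = 0"
  using scaleC_of_real[of 0 x] by simp

lemma cinner_add_left: "cinner (x + y) z = cinner x z + cinner y (z :: 'h :: complex_hilbert)"
  by (metis cinner_add_right cinner_commute complex_cnj_add)

lemma cinner_scaleC_left: "cinner (a *\<^sub>C x) y = cnj a * cinner x (y :: 'h :: complex_hilbert)"
  by (metis cinner_scaleC_right cinner_commute complex_cnj_mult)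

lemma cinner_zero_right: "cinner x (0 :: 'h :: complex_hilbert) = 0"
  using cinner_scaleC_right[of x 0 0] by (simp add: scaleC_zero_left)

lemma cinner_zero_left: "cinner (0 :: 'h :: complex_hilbert) x = 0"
  using cinner_scaleC_left[of 0 0 x] by (simp add: scaleC_zero_left)

lemma cinner_sum_right: "cinner x (\<Sum>i\<in>S. f i) = (\<Sum>i\<in>S. cinner x (f i :: 'h :: complex_hilbert))"
  by (induction S rule: infinite_finite_induct) (simp_all add: cinner_zero_right cinner_add_right)

lemma cinner_sum_left: "cinner (\<Sum>i\<in>S. f i) x = (\<Sum>i\<in>S. cinner (f i :: 'h :: complex_hilbert) x)"
  by (induction S rule: infinite_finite_induct) (simp_all add: cinner_zero_left cinner_add_left)

lemma scaleC_sum_right: "a *\<^sub>C (\<Sum>i\<in>S. f i) = (\<Sum>i\<in>S. a *\<^sub>C (f i :: 'h :: complex_hilbert))"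
proof (induction S rule: infinite_finite_induct)
  have "a *\<^sub>C (0 :: 'h) = 0"
    using scaleC_scaleC[of a 0 "0 :: 'h"] by (simp add: scaleC_zero_left)
  then show "a *\<^sub>C (\<Sum>i\<in>{}. f i) = (\<Sum>i\<in>{}. a *\<^sub>C f i)" "infinite S \<Longrightarrow> a *\<^sub>C (\<Sum>i\<in>S. f i) = (\<Sum>i\<in>S. a *\<^sub>C f i)" for S
    by simp_all
qed (simp add: scaleC_add_right)

lemma scaleC_sum_left: "(\<Sum>i\<in>S. f i) *\<^sub>C x = (\<Sum>i\<in>S. f i *\<^sub>C (x :: 'h :: complex_hilbert))"
  by (induction S rule: infinite_finite_induct) (simp_all add: scaleC_zero_left scaleC_add_left)

lemma cinner_self: "cinner x x = complex_of_real ((norm (x :: 'h :: complex_hilbert))\<^sup>2)"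
  using cinner_commute[of x x] Re_cinner[of x x] by (simp add: complex_eq_iff power2_norm_eq_inner)

lemma Im_cinner: "Im (cinner x y) = inner (\<i> *\<^sub>C x) (y :: 'h :: complex_hilbert)"
  using Re_cinner[of "\<i> *\<^sub>C x" y] by (simp add: cinner_scaleC_left)

lemma tendsto_cinner_right:
  fixes f :: "'b \<Rightarrow> 'h :: complex_hilbert"
  assumes "(f \<longlongrightarrow> a) F" shows "((\<lambda>t. cinner x (f t)) \<longlongrightarrow> cinner x a) F"
  unfolding tendsto_complex_iff Re_cinner Im_cinner
  by (intro conjI tendsto_intros assms)

text \<open>The usual factor 1/4 is moved into the vectors as 1/2, so that the coefficients are
  exactly the i^m with which \<open>has_stieltjes_integral\<close> combines its four parts.\<close>

lemma polarization:
  fixes B :: "'h :: complex_hilbert \<Rightarrow> 'h \<Rightarrow> complex"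
  assumes B: "\<And>x y z. B (x + y) z = B x z + B y z" "\<And>x y z. B x (y + z) = B x y + B x z"
    "\<And>c x y. B (c *\<^sub>C x) y = cnj c * B x y" "\<And>c x y. B x (c *\<^sub>C y) = c * B x y"
  shows "B z x = (\<Sum>m<4. \<i> ^ m * B ((1/2) *\<^sub>C z + ((-\<i>) ^ m / 2) *\<^sub>C x) ((1/2) *\<^sub>C z + ((-\<i>) ^ m / 2) *\<^sub>C x))"
  unfolding sum_lessThan_4 B by (simp add: power3_eq_cube power2_eq_square field_simps)

section \<open>Densities and truncations of finite measures\<close>

lemma (in finite_borel_measure)
  shows distribution_function_cdf: "distribution_function (cdf M)"
    and interval_measure_cdf: "interval_measure (cdf M) = M"
proof -
  show *: "distribution_function (cdf M)"
    by (auto simp: distribution_function_def intro!: monoI cdf_nondecreasing cdf_is_right_cont)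
  show "interval_measure (cdf M) = M"
    by (intro interval_measure_eqI * M_is_borel) (simp add: emeasure_Ioc)
qed

lemma (in finite_borel_measure)
  fixes g :: "real \<Rightarrow> real"
  assumes g: "integrable M g" "\<And>t. 0 \<le> g t"
  shows finite_borel_measure_density: "finite_borel_measure (density M g)"
    and cdf_density: "cdf (density M g) s = (\<integral>t. indicator {..s} t * g t \<partial>M)"
proof -
  have em: "emeasure (density M g) A = ennreal (\<integral>t. indicator A t * g t \<partial>M)" if "A \<in> sets M" for A
  proof -
    have "emeasure (density M g) A = (\<integral>\<^sup>+t. ennreal (indicator A t * g t) \<partial>M)"
      using g(1) that by (subst emeasure_density) (auto intro!: nn_integral_cong simp: indicator_def)
    also have "\<dots> = ennreal (\<integral>t. indicator A t * g t \<partial>M)"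
      using g that by (intro nn_integral_eq_integral integrable_real_mult_indicator[where 'a=real, unfolded mult.commute[of _ "indicator _ _"]]) auto
    finally show ?thesis .
  qed
  show "finite_borel_measure (density M g)"
  proof (intro finite_borel_measure.intro finite_measureI finite_borel_measure_axioms.intro)
    show "emeasure (density M g) (space (density M g)) \<noteq> \<infinity>"
      using em[OF sets.top] by simp
    show "sets (density M g) = sets borel"
      by (simp add: M_is_borel)
  qed
  have "{..s} \<in> sets M" by auto
  then show "cdf (density M g) s = (\<integral>t. indicator {..s} t * g t \<partial>M)"
    using em[of "{..s}"] g(2) by (simp add: cdf_def measure_def integral_nonneg)
qed

text \<open>By \<open>cinner_E\<close>, the product <E s x, E t y> depends on t through min s t
  only. Such a stopped distribution function belongs to the restriction of the measure to the
  half-line up to s.\<close>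

lemma (in finite_borel_measure)
  shows distribution_function_cdf_min: "distribution_function (\<lambda>t. cdf M (min s t))"
    and interval_measure_cdf_min: "interval_measure (\<lambda>t. cdf M (min s t)) = density M (indicator {..s} :: real \<Rightarrow> real)"
proof -
  have ind: "integrable M (indicator {..s} :: real \<Rightarrow> real)"
    by (intro integrable_real_indicator) (auto simp: emeasure_eq_measure)
  interpret N: finite_borel_measure "density M (indicator {..s} :: real \<Rightarrow> real)"
    by (rule finite_borel_measure_density[OF ind]) auto
  have "cdf (density M (indicator {..s} :: real \<Rightarrow> real)) = (\<lambda>t. cdf M (min s t))"
  proof
    fix t
    have "cdf (density M (indicator {..s} :: real \<Rightarrow> real)) t = (\<integral>u. indicator {..min s t} u \<partial>M)"
      unfolding cdf_density[OF ind indicator_pos_le]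
      by (rule Bochner_Integration.integral_cong) (auto simp: indicator_def)
    also have "\<dots> = cdf M (min s t)"
      by (simp add: cdf_def borel_UNIV)
    finally show "cdf (density M (indicator {..s} :: real \<Rightarrow> real)) t = cdf M (min s t)" .
  qed
  then show "distribution_function (\<lambda>t. cdf M (min s t))"
      "interval_measure (\<lambda>t. cdf M (min s t)) = density M (indicator {..s} :: real \<Rightarrow> real)"
    using N.distribution_function_cdf N.interval_measure_cdf by simp_all
qed

section \<open>Scalar spectral measures\<close>

locale spectral_resolution =
  fixes E :: "real \<Rightarrow> 'h :: complex_hilbert \<Rightarrow> 'h"
  assumes resolution: "resolution_of_identity E"
begin

lemma cinner_E: "cinner (E s x) (E t y) = cinner x (E (min s t) y)"
  using resolution unfolding resolution_of_identity_def by metis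

lemma E_symmetric: "cinner (E t x) y = cinner x (E t y)"
  using resolution unfolding resolution_of_identity_def by metis

text \<open>The distribution function of the scalar spectral measure of x. Taking the real part
  loses nothing: E t is an orthogonal projection, so <x, E t x> is the squared norm of E t
  x.\<close>

definition weight :: "'h \<Rightarrow> real \<Rightarrow> real" where
  "weight x t = Re (cinner x (E t x))"

lemma cinner_E_norm: "cinner x (E t x) = complex_of_real ((norm (E t x))\<^sup>2)"
  using cinner_E[of t x t x] unfolding cinner_self by simp

lemma cinner_E_self: "cinner x (E t x) = complex_of_real (weight x t)"
  unfolding weight_def cinner_E_norm Re_complex_of_real ..

lemma weight_eq_norm: "weight x t = (norm (E t x))\<^sup>2"
  unfolding weight_def cinner_E_norm Re_complex_of_real ..

lemma norm_E_le: "norm (E t x) \<le> norm x"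
proof -
  have "(norm (E t x))\<^sup>2 = inner x (E t x)"
    using weight_eq_norm[of x t] by (simp add: weight_def Re_cinner)
  also have "\<dots> \<le> norm x * norm (E t x)" by (rule norm_cauchy_schwarz)
  finally show ?thesis
    by (cases "norm (E t x) = 0") (auto simp: power2_eq_square)
qed

lemma cinner_E_right_continuous: "continuous (at_right t) (\<lambda>t. cinner x (E t y))"
  using resolution unfolding continuous_within resolution_of_identity_def
  by (auto intro!: tendsto_cinner_right)

lemma cinner_E_at_bot: "((\<lambda>t. cinner x (E t y)) \<longlongrightarrow> 0) at_bot"
  using resolution tendsto_cinner_right[of "\<lambda>t. E t y" 0 at_bot x]
  unfolding resolution_of_identity_def by (auto simp: cinner_zero_right)

lemma cinner_E_at_top: "((\<lambda>t. cinner x (E t y)) \<longlongrightarrow> cinner x y) at_top"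
  using resolution unfolding resolution_of_identity_def
  by (auto intro!: tendsto_cinner_right)

lemma weight_mono: "s \<le> t \<Longrightarrow> weight x s \<le> weight x t"
proof -
  assume "s \<le> t"
  then have "E s x = E s (E t x)"
    using resolution unfolding resolution_of_identity_def by (simp add: min_def)
  then have "norm (E s x) \<le> norm (E t x)" using norm_E_le[of s "E t x"] by simp
  then show ?thesis by (simp add: weight_eq_norm power_mono)
qed

lemma distribution_function_weight: "distribution_function (weight x)"
proof -
  have "continuous (at_right t) (weight x)" for t
    unfolding weight_def[abs_def] by (rule continuous_Re[OF cinner_E_right_continuous])
  then show ?thesis
    unfolding distribution_function_def by (auto intro: monoI weight_mono)
qed

lemma
  shows finite_borel_measure_weight: "finite_borel_measure (interval_measure (weight x))"
    and cdf_weight: "cdf (interval_measure (weight x)) = weight x"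
    and measure_weight_UNIV: "measure (interval_measure (weight x)) UNIV = (norm x)\<^sup>2"
proof -
  have lim: "(weight x \<longlongrightarrow> 0) at_bot" "(weight x \<longlongrightarrow> (norm x)\<^sup>2) at_top"
    using tendsto_Re[OF cinner_E_at_bot[of x x]] tendsto_Re[OF cinner_E_at_top[of x x]]
    by (simp_all add: weight_def[abs_def] cinner_self)
  note D = distribution_function_weight[of x, unfolded distribution_function_def]
  show "finite_borel_measure (interval_measure (weight x))"
    using D lim by (intro finite_borel_measure_interval_measure weight_mono) auto
  show "cdf (interval_measure (weight x)) = weight x"
    using D lim by (intro cdf_interval_measure weight_mono) auto
  have "emeasure (interval_measure (weight x)) UNIV = ennreal ((norm x)\<^sup>2)"
    using D lim by (intro interval_measure_UNIV weight_mono) auto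
  then show "measure (interval_measure (weight x)) UNIV = (norm x)\<^sup>2"
    by (simp add: measure_def)
qed

end

text \<open>Density and truncation combined. The density has to be nonnegative, so the signed
  density t enters later through its positive and negative part.\<close>

lemma (in finite_borel_measure)
  fixes g :: "real \<Rightarrow> real" and f :: "real \<Rightarrow> complex"
  assumes g: "integrable M g" "\<And>t. 0 \<le> g t" and f: "f \<in> borel_measurable borel"
    and gf: "integrable M (\<lambda>t. g t *\<^sub>R f t)"
  shows distribution_function_cdf_density_min: "distribution_function (\<lambda>t. cdf (density M g) (min s t))"
    and integrable_cdf_density_min: "integrable (interval_measure (\<lambda>t. cdf (density M g) (min s t))) f"
    and integral_cdf_density_min: "integral\<^sup>L (interval_measure (\<lambda>t. cdf (density M g) (min s t))) f =
      (\<integral>t. indicator {..s} t *\<^sub>R (g t *\<^sub>R f t) \<partial>M)"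
proof -
  interpret N: finite_borel_measure "density M g"
    by (rule finite_borel_measure_density[OF g])
  have [measurable]: "g \<in> borel_measurable M" "f \<in> borel_measurable M" "{..s} \<in> sets M"
    using g(1) f M_is_borel by (auto cong: measurable_cong_sets)
  show "distribution_function (\<lambda>t. cdf (density M g) (min s t))"
    by (rule N.distribution_function_cdf_min)
  have comm: "g t *\<^sub>R (indicator {..s} t *\<^sub>R f t) = indicator {..s} t *\<^sub>R (g t *\<^sub>R f t)" for t
    by simp
  have "integrable M (\<lambda>t. indicator {..s} t *\<^sub>R (g t *\<^sub>R f t))"
    by (rule integrable_mult_indicator[OF _ gf]) measurable
  then show "integrable (interval_measure (\<lambda>t. cdf (density M g) (min s t))) f"
    unfolding N.interval_measure_cdf_min
    by (simp add: integrable_density g(2) comm del: scaleR_scaleR)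
  show "integral\<^sup>L (interval_measure (\<lambda>t. cdf (density M g) (min s t))) f =
      (\<integral>t. indicator {..s} t *\<^sub>R (g t *\<^sub>R f t) \<partial>M)"
    unfolding N.interval_measure_cdf_min
    by (simp add: integral_density g(2) comm del: scaleR_scaleR)
qed

context spectral_resolution
begin

text \<open>
  Testing the defining property of \<^const>\<open>spectral_operator\<close> against \<open>E s w\<close> and \<open>E s y\<close> truncates the
  integral at \<open>s\<close>, because \<open>\<langle>E s z, E t w\<rangle>\<close> is constant for \<open>t \<ge> s\<close>.
\<close>

lemma spectral_operator_pair:
  assumes wy: "(w, y) \<in> spectral_operator E"
  defines "M \<equiv> interval_measure (weight w)"
  shows "integrable M (\<lambda>t. t\<^sup>2)" "integrable M (\<lambda>t. t)"
    and "cinner w y = complex_of_real (\<integral>t. t \<partial>M)"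
    and "interval_measure (weight y) = density M (\<lambda>t. t\<^sup>2)"
proof -
  interpret finite_borel_measure M
    unfolding M_def by (rule finite_borel_measure_weight)
  have [measurable_cong]: "sets M = sets borel" by (rule M_is_borel)
  have cdfM: "cdf M = weight w" unfolding M_def by (rule cdf_weight)
  have imM: "interval_measure (weight w) = M" by (simp add: M_def)
  show int2: "integrable M (\<lambda>t. t\<^sup>2)"
    using wy unfolding spectral_operator_def M_def weight_def[abs_def] by simp
  have si: "has_stieltjes_integral complex_of_real (\<lambda>t. cinner z (E t w)) (cinner z y)" for z
    using wy unfolding spectral_operator_def by simp
  show int1: "integrable M (\<lambda>t. t)"
  proof (rule Bochner_Integration.integrable_bound)
    show "integrable M (\<lambda>t. 1 + t\<^sup>2)" using int2 by simp
    have "\<bar>t\<bar> \<le> 1 + t\<^sup>2" for t :: real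
    proof -
      have "0 \<le> (\<bar>t\<bar> - 1)\<^sup>2" "0 \<le> t\<^sup>2" by simp_all
      then show ?thesis by (simp add: power2_diff)
    qed
    then show "AE t in M. norm t \<le> norm (1 + t\<^sup>2)"
      by (intro AE_I2) (simp add: abs_of_nonneg)
  qed simp
  have c1: "integrable M complex_of_real"
    using integrable_of_real[OF int1] by simp
  have "has_stieltjes_integral complex_of_real (\<lambda>t. complex_of_real (weight w t - 0))
      (integral\<^sup>L M complex_of_real - integral\<^sup>L (interval_measure (\<lambda>_. 0)) complex_of_real)"
    unfolding M_def using c1 unfolding M_def
    by (intro has_stieltjes_integral_diff distribution_function_weight distribution_function_const)
      (simp_all add: interval_measure_const integrable_null_measure)
  then have "has_stieltjes_integral complex_of_real (\<lambda>t. cinner w (E t w)) (complex_of_real (\<integral>t. t \<partial>M))"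
    by (simp add: interval_measure_const cinner_E_self)
  then show "cinner w y = complex_of_real (\<integral>t. t \<partial>M)"
    using si[of w] has_stieltjes_integral_unique by blast
  have bm: "complex_of_real \<in> borel_measurable borel" by measurable
  \<comment> \<open>Choosing z = E s w makes the integrator \<open>weight w\<close> stopped at s.
    The result says that the complex measure of <w, E t y> has density t with respect to M.\<close>
  have H: "cinner w (E s y) = complex_of_real (\<integral>t. indicator {..s} t * t \<partial>M)" for s
  proof -
    have one: "integrable M (\<lambda>t. 1 :: real)" "integrable M (\<lambda>t. (1 :: real) *\<^sub>R complex_of_real t)"
      using c1 by simp_all
    have dens: "density M (\<lambda>t. ennreal 1) = M" by (simp add: density_1)
    note R = distribution_function_cdf_density_min[OF one(1) zero_le_one bm one(2), of s, unfolded dens cdfM]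
      integrable_cdf_density_min[OF one(1) zero_le_one bm one(2), of s, unfolded dens cdfM]
      integral_cdf_density_min[OF one(1) zero_le_one bm one(2), of s, unfolded dens cdfM]
    have "has_stieltjes_integral complex_of_real (\<lambda>t. complex_of_real (weight w (min s t) - 0))
      (integral\<^sup>L (interval_measure (\<lambda>t. weight w (min s t))) complex_of_real - integral\<^sup>L (interval_measure (\<lambda>_. 0)) complex_of_real)"
      by (intro has_stieltjes_integral_diff distribution_function_const R(1,2))
        (simp add: interval_measure_const integrable_null_measure)
    moreover have "(\<lambda>t. complex_of_real (weight w (min s t) - 0)) = (\<lambda>t. cinner (E s w) (E t w))"
      by (simp add: cinner_E cinner_E_self)
    moreover have "integral\<^sup>L (interval_measure (\<lambda>t. weight w (min s t))) complex_of_real =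
        complex_of_real (\<integral>t. indicator {..s} t * t \<partial>M)"
      using R(3) by (simp add: scaleR_conv_of_real of_real_mult[symmetric] del: of_real_mult)
    ultimately have "has_stieltjes_integral complex_of_real (\<lambda>t. cinner (E s w) (E t w))
        (complex_of_real (\<integral>t. indicator {..s} t * t \<partial>M))"
      by (simp add: interval_measure_const)
    then have "cinner (E s w) y = complex_of_real (\<integral>t. indicator {..s} t * t \<partial>M)"
      using si[of "E s w"] has_stieltjes_integral_unique by blast
    then show ?thesis by (simp add: E_symmetric)
  qed
  \<comment> \<open>g 1 and g (- 1) are the positive and the negative part of t: the measure t dM is
    signed, whereas the parts of a Stieltjes integral have to be nondecreasing.\<close>
  define g where "g = (\<lambda>\<epsilon> t. max 0 (\<epsilon> * t :: real))"
  have g: "integrable M (g \<epsilon>)" "0 \<le> g \<epsilon> t" for \<epsilon> t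
    unfolding g_def using int1 by (auto intro!: Bochner_Integration.integrable_max)
  have gint: "integrable M (\<lambda>t. g \<epsilon> t * t)" if "\<bar>\<epsilon>\<bar> = 1" for \<epsilon>
  proof (rule Bochner_Integration.integrable_bound[OF int2])
    show "AE t in M. norm (g \<epsilon> t * t) \<le> norm (t\<^sup>2)"
    proof (rule AE_I2)
      fix t
      have "\<bar>g \<epsilon> t\<bar> \<le> \<bar>\<epsilon> * t\<bar>" by (simp add: g_def max_def)
      then have "\<bar>g \<epsilon> t\<bar> * \<bar>t\<bar> \<le> \<bar>t\<bar> * \<bar>t\<bar>"
        using that by (intro mult_right_mono) (simp_all add: abs_mult)
      then show "norm (g \<epsilon> t * t) \<le> norm (t\<^sup>2)"
        by (simp add: abs_mult power2_eq_square)
    qed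
  qed (auto simp: g_def)
  have gintc: "integrable M (\<lambda>t. g \<epsilon> t *\<^sub>R complex_of_real t)" if "\<bar>\<epsilon>\<bar> = 1" for \<epsilon>
    using integrable_of_real[OF gint[OF that], where 'a=complex] by (simp add: scaleR_conv_of_real)
  have gp: "integrable M (\<lambda>t. g 1 t *\<^sub>R complex_of_real t)"
    and gm: "integrable M (\<lambda>t. g (- 1) t *\<^sub>R complex_of_real t)"
    by (simp_all add: gintc)
  have split: "g 1 t - g (- 1) t = t" for t
    by (simp add: g_def max_def)
  have indI: "integrable M (\<lambda>t. indicator {..s} t * f t)" if "integrable M f" for f :: "real \<Rightarrow> real" and s
    using integrable_mult_indicator[OF _ that, of "{..s}"] by simp
  \<comment> \<open>Now z = E s y. By \<open>H\<close> the integrator <E s y, E t w> belongs to the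
    measure t dM stopped at s, and integrating t against it produces t^2 dM.\<close>
  have G: "cinner y (E s y) = complex_of_real (\<integral>t. indicator {..s} t * t\<^sup>2 \<partial>M)" for s
  proof -
    let ?N = "\<lambda>\<epsilon>. density M (g \<epsilon>)"
    have "cinner (E s y) (E t w) = complex_of_real (cdf (?N 1) (min s t) - cdf (?N (-1)) (min s t))" for t
    proof -
      have "cinner (E s y) (E t w) = cnj (cinner w (E (min s t) y))"
        unfolding cinner_E by (metis E_symmetric cinner_commute)
      also have "\<dots> = complex_of_real (\<integral>u. indicator {..min s t} u * (g 1 u - g (-1) u) \<partial>M)"
        unfolding H split by simp
      also have "(\<integral>u. indicator {..min s t} u * (g 1 u - g (-1) u) \<partial>M) =
          cdf (?N 1) (min s t) - cdf (?N (-1)) (min s t)"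
        unfolding cdf_density[OF g] right_diff_distrib
        by (intro Bochner_Integration.integral_diff indI g)
      finally show ?thesis .
    qed
    moreover have "has_stieltjes_integral complex_of_real
        (\<lambda>t. complex_of_real (cdf (?N 1) (min s t) - cdf (?N (-1)) (min s t)))
        ((\<integral>t. indicator {..s} t *\<^sub>R (g 1 t *\<^sub>R complex_of_real t) \<partial>M) -
         (\<integral>t. indicator {..s} t *\<^sub>R (g (-1) t *\<^sub>R complex_of_real t) \<partial>M))"
      unfolding integral_cdf_density_min[OF g bm gp, symmetric] integral_cdf_density_min[OF g bm gm, symmetric]
      by (intro has_stieltjes_integral_diff distribution_function_cdf_density_min[OF g bm]
          integrable_cdf_density_min[OF g bm] gp gm)
    ultimately have "has_stieltjes_integral complex_of_real (\<lambda>t. cinner (E s y) (E t w))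
        ((\<integral>t. indicator {..s} t *\<^sub>R (g 1 t *\<^sub>R complex_of_real t) \<partial>M) -
         (\<integral>t. indicator {..s} t *\<^sub>R (g (-1) t *\<^sub>R complex_of_real t) \<partial>M))"
      by simp
    moreover have "(\<integral>t. indicator {..s} t *\<^sub>R (g 1 t *\<^sub>R complex_of_real t) \<partial>M) -
         (\<integral>t. indicator {..s} t *\<^sub>R (g (-1) t *\<^sub>R complex_of_real t) \<partial>M) =
         complex_of_real (\<integral>t. indicator {..s} t * t\<^sup>2 \<partial>M)"
    proof -
      have "(\<integral>t. indicator {..s} t *\<^sub>R (g \<epsilon> t *\<^sub>R complex_of_real t) \<partial>M) =
          complex_of_real (\<integral>t. indicator {..s} t * (g \<epsilon> t * t) \<partial>M)"
        if "\<bar>\<epsilon>\<bar> = 1" for \<epsilon>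
        unfolding scaleR_conv_of_real of_real_mult[symmetric] by (intro integral_of_real indI gint that)
      moreover have "(\<integral>t. indicator {..s} t * (g 1 t * t) \<partial>M) - (\<integral>t. indicator {..s} t * (g (-1) t * t) \<partial>M) =
          (\<integral>t. indicator {..s} t * t\<^sup>2 \<partial>M)"
      proof -
        have "g 1 t * t - g (-1) t * t = t\<^sup>2" for t
          using split[of t] by (simp add: left_diff_distrib[symmetric] power2_eq_square)
        then show ?thesis
          by (subst Bochner_Integration.integral_diff[symmetric])
            (simp_all add: indI gint right_diff_distrib[symmetric])
      qed
      ultimately show ?thesis by (simp flip: of_real_diff)
    qed
    ultimately have "cinner (E s y) y = complex_of_real (\<integral>t. indicator {..s} t * t\<^sup>2 \<partial>M)"
      using si[of "E s y"] has_stieltjes_integral_unique by simp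
    then show ?thesis by (simp add: E_symmetric)
  qed
  interpret N: finite_borel_measure "density M (\<lambda>t. t\<^sup>2)"
    by (rule finite_borel_measure_density[OF int2]) simp
  have "cdf (density M (\<lambda>t. t\<^sup>2)) = weight y"
    using G by (simp add: fun_eq_iff cdf_density[OF int2] weight_def)
  then show "interval_measure (weight y) = density M (\<lambda>t. t\<^sup>2)"
    using N.interval_measure_cdf by simp
qed

end

section \<open>Moments of a self-adjoint operator\<close>

locale selfadjoint_resolution = spectral_resolution +
  assumes selfadjoint: "adjoint_operator (spectral_operator E) = spectral_operator E"
begin

lemma spectral_operator_symmetric:
  assumes "(x, y) \<in> spectral_operator E" "(u, v) \<in> spectral_operator E"
  shows "cinner x v = cinner y u"
  using assms selfadjoint unfolding adjoint_operator_def by blast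

text \<open>Membership in an adjoint is a linear condition on the pair, so equality with the adjoint
  yields linearity without returning to the integrals that define the graph.\<close>

lemma spectral_operator_linear:
  assumes "(x, y) \<in> spectral_operator E" "(u, v) \<in> spectral_operator E"
  shows "(a *\<^sub>C x + b *\<^sub>C u, a *\<^sub>C y + b *\<^sub>C v) \<in> spectral_operator E"
  using assms
  by (subst selfadjoint[symmetric])
    (auto simp: adjoint_operator_def cinner_add_left cinner_scaleC_left spectral_operator_symmetric)

text \<open>Each induction step gains two powers. Dropping w 0 leaves a chain starting at w 1, whose
  spectral measure is t^2 times that of w 0, and symmetry gives <w 0, w (k + 2)> = <w 1, w (k + 1)>.
  Moment k of the shorter chain is thus moment k + 2 of the original one.\<close>

lemma spectral_moment_self:
  assumes "\<And>k. (w k, w (Suc k)) \<in> spectral_operator E"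
  shows "integrable (interval_measure (weight (w 0))) (\<lambda>t. t ^ k) \<and>
    cinner (w 0) (w k) = complex_of_real (\<integral>t. t ^ k \<partial>interval_measure (weight (w 0)))"
  using assms
proof (induction k arbitrary: w rule: induct_nat_012)
  case 0
  interpret finite_borel_measure "interval_measure (weight (w 0))"
    by (rule finite_borel_measure_weight)
  show ?case using measure_weight_UNIV[of "w 0"] by (simp add: cinner_self)
next
  case 1
  show ?case using spectral_operator_pair[OF 1[of 0]] by simp
next
  case (ge2 k)
  let ?M = "interval_measure (weight (w 0))"
  note * = ge2(1)[of "\<lambda>k. w (Suc k)", OF ge2(3)]
  note D = spectral_operator_pair(4)[OF ge2(3)[of 0]]
  have "integrable ?M (\<lambda>t. t\<^sup>2 *\<^sub>R t ^ k)"
    using * unfolding D by (subst (asm) integrable_density) auto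
  moreover have "integral\<^sup>L (density ?M (\<lambda>t. t\<^sup>2)) (\<lambda>t. t ^ k) = (\<integral>t. t\<^sup>2 *\<^sub>R t ^ k \<partial>?M)"
    by (rule integral_density) auto
  moreover have "cinner (w 0) (w (Suc (Suc k))) = cinner (w (Suc 0)) (w (Suc k))"
    by (intro spectral_operator_symmetric ge2(3))
  ultimately show ?case
    using * unfolding D by (simp add: power2_eq_square mult.assoc)
qed

text \<open>The combinations of the two chains occurring in \<open>polarization\<close> are again
  chains, so \<open>spectral_moment_self\<close> applies to each. The resulting four weights
  decompose <z 0, E t (x 0)> independently of k.\<close>

lemma spectral_moment:
  assumes x: "\<And>k. (x k, x (Suc k)) \<in> spectral_operator E"
    and z: "\<And>k. (z k, z (Suc k)) \<in> spectral_operator E"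
  shows "has_stieltjes_integral (\<lambda>t. complex_of_real (t ^ k)) (\<lambda>t. cinner (z 0) (E t (x 0))) (cinner (z 0) (x k))"
proof -
  define u where "u m k = (1/2) *\<^sub>C z k + ((-\<i>) ^ m / 2) *\<^sub>C x k" for m k
  have u: "(u m k, u m (Suc k)) \<in> spectral_operator E" for m k
    unfolding u_def by (intro spectral_operator_linear x z)
  note mom = spectral_moment_self[of "u _", OF u]
  have E_linear: "cinner x (E t (y + z)) = cinner x (E t y) + cinner x (E t z)"
    "cinner x (E t (c *\<^sub>C y)) = c * cinner x (E t y)" for x y z c t
    by (simp_all add: E_symmetric[symmetric] cinner_add_right cinner_scaleC_right)
  have "cinner (z 0) (E t (x 0)) = (\<Sum>m<4. \<i> ^ m * complex_of_real (weight (u m 0) t))" for t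
    unfolding cinner_E_self[symmetric] u_def
    by (rule polarization[where B="\<lambda>x y. cinner x (E t y)"])
      (simp_all add: cinner_add_left cinner_scaleC_left E_linear)
  moreover have "\<forall>m<4. distribution_function (weight (u m 0)) \<and>
      integrable (interval_measure (weight (u m 0))) (\<lambda>t. complex_of_real (t ^ k))"
    using mom by (auto intro: distribution_function_weight simp del: of_real_power)
  ultimately have "has_stieltjes_integral (\<lambda>t. complex_of_real (t ^ k)) (\<lambda>t. cinner (z 0) (E t (x 0)))
      (\<Sum>m<4. \<i> ^ m * integral\<^sup>L (interval_measure (weight (u m 0))) (\<lambda>t. complex_of_real (t ^ k)))"
    by (intro has_stieltjes_integralI)
  moreover have "cinner (z 0) (x k) = (\<Sum>m<4. \<i> ^ m * cinner (u m 0) (u m k))"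
  proof -
    show ?thesis
      unfolding u_def sum_lessThan_4 cinner_add_left cinner_add_right cinner_scaleC_left cinner_scaleC_right
      by (simp add: power3_eq_cube power2_eq_square field_simps)
  qed
  ultimately show ?thesis
    using mom by (simp del: of_real_power)
qed

end

section \<open>The Gram--Schmidt procedure\<close>

abbreviation (input) eval_vpoly :: "vpoly \<Rightarrow> nat \<Rightarrow> real \<Rightarrow> complex" where
  "eval_vpoly f i t \<equiv> poly (f $ i) (complex_of_real t)"

section \<open>Null functions and orthonormality\<close>

context matrix_distribution
begin

lemma form_sum_right:
  assumes "\<And>i. i < n \<Longrightarrow> polynomial_fun (f i)" "\<And>a i. a \<in> S \<Longrightarrow> i < n \<Longrightarrow> polynomial_fun (g a i)"
  shows "form f (\<lambda>i t. \<Sum>a\<in>S. c a * g a i t) = (\<Sum>a\<in>S. c a * form f (g a))"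
  using assms(2)
proof (induction S rule: infinite_finite_induct)
  case (insert x S)
  then show ?case
    by (simp add: form_add_right assms(1) polynomial_fun_intros form_cmult_right)
qed (use form_cmult_right[of f 0 "\<lambda>i t. 0"] in simp_all)

lemma form_sum_left:
  assumes "\<And>i. i < n \<Longrightarrow> polynomial_fun (f i)" "\<And>a i. a \<in> S \<Longrightarrow> i < n \<Longrightarrow> polynomial_fun (g a i)"
  shows "form (\<lambda>i t. \<Sum>a\<in>S. c a * g a i t) f = (\<Sum>a\<in>S. cnj (c a) * form (g a) f)"
  using assms(2)
proof (induction S rule: infinite_finite_induct)
  case (insert x S)
  then show ?case
    by (simp add: form_add_left assms(1) polynomial_fun_intros form_cmult_left)
qed (use form_cmult_left[of 0 "\<lambda>i t. 0" f] in simp_all)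

definition null :: "(nat \<Rightarrow> real \<Rightarrow> complex) \<Rightarrow> bool" where
  "null h \<longleftrightarrow> (\<forall>i<n. polynomial_fun (h i)) \<and> form h h = 0"

lemma null_form:
  assumes "null h" "\<And>i. i < n \<Longrightarrow> polynomial_fun (g i)"
  shows "form g h = 0" "form h g = 0"
  using assms form_null[of h g] by (auto simp: null_def)

lemma null_zero: "null (\<lambda>i t. 0)"
  using form_cmult_left[of 0 "\<lambda>i t. 0"] by (simp add: null_def polynomial_fun_const)

lemma null_add:
  assumes "null h" "null k" shows "null (\<lambda>i t. h i t + k i t)"
proof -
  have p: "polynomial_fun (h i)" "polynomial_fun (k i)" if "i < n" for i
    using assms that by (auto simp: null_def)
  then show ?thesis
    using null_form[OF assms(1) p(2)] assms
    by (simp add: null_def polynomial_fun_intros form_add_left form_add_right)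
qed

lemma null_sum: "(\<And>a. a \<in> S \<Longrightarrow> null (h a)) \<Longrightarrow> null (\<lambda>i t. \<Sum>a\<in>S. h a i t)"
  by (induction S rule: infinite_finite_induct) (simp_all add: null_zero null_add)

text \<open>Moving one factor to the other side turns the square of r h into the product of |r|^2 h
  with the null function h, which vanishes. Null functions thus form a module over the polynomials,
  and every multiple of some q j in the expansion of z p k is null.\<close>

lemma null_mult:
  assumes h: "null h" and r: "polynomial_fun r" shows "null (\<lambda>i t. r t * h i t)"
proof -
  have p: "polynomial_fun (h i)" if "i < n" for i
    using h that by (auto simp: null_def)
  have "form (\<lambda>i t. r t * h i t) (\<lambda>i t. r t * h i t) = form (\<lambda>i t. cnj (r t) * (r t * h i t)) h"
    by (rule form_mult_shift)
  also have "\<dots> = 0" by (intro null_form h polynomial_fun_intros r p)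
  finally show ?thesis by (simp add: null_def polynomial_fun_intros r p)
qed

lemma eval_gs_residual:
  assumes "i < n"
  shows "eval_vpoly (gs_residual n \<sigma> ps k) i t = eval_vpoly (basis_vpoly n k) i t +
     (\<Sum>a<length ps. - L2_inner n \<sigma> (ps ! a) (basis_vpoly n k) * eval_vpoly (ps ! a) i t)"
  using assms by (simp add: gs_residual_def poly_sum sum_negf)

definition orthonormal :: "vpoly list \<Rightarrow> bool" where
  "orthonormal ps \<longleftrightarrow> (\<forall>a<length ps. \<forall>b<length ps. L2_inner n \<sigma> (ps ! a) (ps ! b) = (if a = b then 1 else 0))"

lemma orthonormal_residual:
  assumes "orthonormal ps" "b < length ps"
  shows "L2_inner n \<sigma> (ps ! b) (gs_residual n \<sigma> ps k) = 0"
proof -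
  define c where "c a = - L2_inner n \<sigma> (ps ! a) (basis_vpoly n k)" for a
  have "form (eval_vpoly (ps ! b)) (eval_vpoly (gs_residual n \<sigma> ps k)) =
     form (eval_vpoly (ps ! b)) (\<lambda>i t. eval_vpoly (basis_vpoly n k) i t + (\<Sum>a<length ps. c a * eval_vpoly (ps ! a) i t))"
    unfolding c_def by (rule form_cong[OF refl eval_gs_residual])
  also have "\<dots> = L2_inner n \<sigma> (ps ! b) (basis_vpoly n k) + (\<Sum>a<length ps. c a * L2_inner n \<sigma> (ps ! b) (ps ! a))"
    unfolding L2_inner_eq_form by (simp add: form_add_right polynomial_fun_intros form_sum_right)
  also have "(\<Sum>a<length ps. c a * L2_inner n \<sigma> (ps ! b) (ps ! a)) = (\<Sum>a<length ps. if a = b then c b else 0)"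
    using assms by (intro sum.cong) (auto simp: orthonormal_def)
  also have "L2_inner n \<sigma> (ps ! b) (basis_vpoly n k) + \<dots> = 0"
    using assms(2) by (simp add: c_def)
  finally show ?thesis unfolding L2_inner_eq_form .
qed

lemma L2_inner_self: "L2_inner n \<sigma> f f = complex_of_real ((L2_norm n \<sigma> f)\<^sup>2)"
  using form_self_nonneg[of "eval_vpoly f"]
  by (simp add: L2_norm_def L2_inner_eq_form polynomial_fun_intros complex_eq_iff)

lemma L2_inner_commute: "L2_inner n \<sigma> f g = cnj (L2_inner n \<sigma> g f)"
  unfolding L2_inner_eq_form by (intro form_commute polynomial_fun_intros)

lemma orthonormal_snoc:
  assumes ps: "orthonormal ps" and r: "r = gs_residual n \<sigma> ps k" and nz: "L2_norm n \<sigma> r \<noteq> 0"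
  shows "orthonormal (ps @ [[:complex_of_real (1 / L2_norm n \<sigma> r):] \<cdot>\<^sub>v r])"
proof -
  let ?c = "complex_of_real (1 / L2_norm n \<sigma> r)"
  let ?p = "[:?c:] \<cdot>\<^sub>v r"
  have dim: "dim_vec r = n" by (simp add: r gs_residual_def)
  have ev: "eval_vpoly ?p i t = ?c * eval_vpoly r i t" if "i < n" for i t
    using that dim by simp
  have right: "L2_inner n \<sigma> f ?p = ?c * L2_inner n \<sigma> f r" for f
  proof -
    have "L2_inner n \<sigma> f ?p = form (eval_vpoly f) (\<lambda>i t. ?c * eval_vpoly r i t)"
      unfolding L2_inner_eq_form by (rule form_cong[OF refl ev])
    then show ?thesis unfolding L2_inner_eq_form form_cmult_right .
  qed
  have left: "L2_inner n \<sigma> ?p f = ?c * L2_inner n \<sigma> r f" for f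
    using L2_inner_commute[of ?p f] L2_inner_commute[of r f] right[of f] by simp
  have zero: "L2_inner n \<sigma> (ps ! a) ?p = 0" "L2_inner n \<sigma> ?p (ps ! a) = 0" if "a < length ps" for a
    using orthonormal_residual[OF ps that, of k] L2_inner_commute[of r "ps ! a"]
    unfolding right left r[symmetric] by simp_all
  have one: "L2_inner n \<sigma> ?p ?p = 1"
  proof -
    have "L2_inner n \<sigma> ?p ?p = ?c * (?c * L2_inner n \<sigma> r r)" by (simp only: right left)
    then show ?thesis using nz by (simp add: L2_inner_self[of r] power2_eq_square)
  qed
  show ?thesis
    using ps zero one unfolding orthonormal_def by (auto simp: nth_append less_Suc_eq)
qed

lemma gs_lists_orthonormal:
  "orthonormal (fst (gs_lists n \<sigma> k)) \<and> (\<forall>q\<in>set (snd (gs_lists n \<sigma> k)). null (eval_vpoly q))"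
proof (induction k)
  case 0
  show ?case by (simp add: orthonormal_def)
next
  case (Suc k)
  obtain ps qs where g: "gs_lists n \<sigma> k = (ps, qs)" by fastforce
  have "null (eval_vpoly (gs_residual n \<sigma> ps k))" if "L2_norm n \<sigma> (gs_residual n \<sigma> ps k) = 0"
    using L2_inner_self[of "gs_residual n \<sigma> ps k"] that
    by (simp add: null_def polynomial_fun_intros L2_inner_eq_form)
  then show ?case
    using Suc orthonormal_snoc[of ps "gs_residual n \<sigma> ps k" k] by (auto simp: g Let_def)
qed

end

lemma gs_lists_prefix:
  "k \<le> l \<Longrightarrow> \<exists>xs. fst (gs_lists n \<sigma> l) = fst (gs_lists n \<sigma> k) @ xs"
proof (induction l rule: dec_induct)
  case (step l)
  then show ?case by (auto simp: Let_def split: prod.split)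
qed simp

lemma gs_lists_nth_mono:
  "k \<le> l \<Longrightarrow> i < length (fst (gs_lists n \<sigma> k)) \<Longrightarrow>
    i < length (fst (gs_lists n \<sigma> l)) \<and> fst (gs_lists n \<sigma> l) ! i = fst (gs_lists n \<sigma> k) ! i"
  using gs_lists_prefix[of k l n \<sigma>] by (auto simp: nth_append)

text \<open>The definition ties p i to some stage only; as later stages merely append, every stage
  that has an entry i agrees with it.\<close>

lemma gram_schmidt_output_nth:
  assumes "gram_schmidt_output n \<sigma> p j\<^sub>0 q" "i < length (fst (gs_lists n \<sigma> k))"
  shows "p i = fst (gs_lists n \<sigma> k) ! i"
proof -
  obtain l where "i < length (fst (gs_lists n \<sigma> l))" "p i = fst (gs_lists n \<sigma> l) ! i"
    using assms(1) unfolding gram_schmidt_output_def by blast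
  then show ?thesis
    using gs_lists_nth_mono[of k l i n \<sigma>] gs_lists_nth_mono[of l k i n \<sigma>] assms(2) by (metis nat_le_linear)
qed

context matrix_distribution
begin

lemma gram_schmidt_output_orthonormal:
  assumes gs: "gram_schmidt_output n \<sigma> p j\<^sub>0 q"
  shows "L2_inner n \<sigma> (p a) (p b) = (if a = b then 1 else 0)"
proof -
  obtain k l where k: "a < length (fst (gs_lists n \<sigma> k))" and l: "b < length (fst (gs_lists n \<sigma> l))"
    using gs unfolding gram_schmidt_output_def by blast
  define m where "m = max k l"
  have m: "a < length (fst (gs_lists n \<sigma> m))" "b < length (fst (gs_lists n \<sigma> m))"
    using gs_lists_nth_mono[of k m a n \<sigma>] gs_lists_nth_mono[of l m b n \<sigma>] k l by (auto simp: m_def)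
  show ?thesis
    using gs_lists_orthonormal[of m] m unfolding orthonormal_def
    by (simp add: gram_schmidt_output_nth[OF gs m(1)] gram_schmidt_output_nth[OF gs m(2)])
qed

lemma gram_schmidt_output_null:
  assumes "gram_schmidt_output n \<sigma> p j\<^sub>0 q" "j < j\<^sub>0"
  shows "null (eval_vpoly (q j))"
  using assms gs_lists_orthonormal unfolding gram_schmidt_output_def by (metis nth_mem)

section \<open>Constant vectors and the first n steps\<close>

lemma form_const:
  "form (\<lambda>i t. a i) (\<lambda>i t. b i) = (\<Sum>i<n. \<Sum>j<n. cnj (a i) * b j * entry_integral i j (\<lambda>t. 1))"
proof -
  have "entry_integral i j (\<lambda>t. cnj (a i) * b j) = cnj (a i) * b j * entry_integral i j (\<lambda>t. 1)" for i j
    using entry_integral_cmult[of i j "cnj (a i) * b j" "\<lambda>t. 1"] by (simp only: mult.right_neutral)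
  then show ?thesis unfolding form_def by (simp only:)
qed

lemma matrix_moment_0: "i < n \<Longrightarrow> j < n \<Longrightarrow> matrix_moment n \<sigma> 0 $$ (i, j) = entry_integral i j (\<lambda>t. 1)"
  by (simp add: matrix_moment_def stieltjes_integral_entry polynomial_fun_intros)

text \<open>Pairing a null constant u with each unit vector gives S_0 u = 0, and S_0 is invertible.
  This excludes zero-norm polynomials during the first n steps.\<close>

lemma null_const_eq_0:
  assumes inv: "invertible_mat (matrix_moment n \<sigma> 0)" and null: "null (\<lambda>i t. u i)" and k: "k < n"
  shows "u k = 0"
proof -
  let ?S = "matrix_moment n \<sigma> 0"
  have S: "?S \<in> carrier_mat n n" by (simp add: matrix_moment_def)
  have row: "(\<Sum>j<n. ?S $$ (i, j) * u j) = 0" if i: "i < n" for i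
  proof -
    have "0 = form (\<lambda>m t. if m = i then 1 else 0) (\<lambda>i t. u i)"
      by (rule null_form(1)[OF null, symmetric]) (rule polynomial_fun_const)
    also have "\<dots> = (\<Sum>m<n. if m = i then \<Sum>j<n. u j * ?S $$ (m, j) else 0)"
      unfolding form_const by (intro sum.cong refl) (simp add: matrix_moment_0)
    finally show ?thesis using i by (simp add: sum.delta mult.commute)
  qed
  have "?S *\<^sub>v vec n u = 0\<^sub>v n"
  proof (rule eq_vecI)
    fix i assume "i < dim_vec (0\<^sub>v n :: complex vec)"
    then show "(?S *\<^sub>v vec n u) $ i = 0\<^sub>v n $ i"
      using S row[of i] by (simp add: scalar_prod_def lessThan_atLeast0)
  qed (use S in simp)
  \<comment> \<open>\<open>invertible_mat\<close> leaves the size of the inverse open; it is read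
    off from the two product equations.\<close>
  moreover have "\<exists>B. B * ?S = 1\<^sub>m n \<and> B \<in> carrier_mat n n"
  proof -
    obtain B where AB: "?S * B = 1\<^sub>m n" and BA: "B * ?S = 1\<^sub>m (dim_row B)"
      using inv S unfolding invertible_mat_def inverts_mat_def by auto
    have "dim_col B = n" using arg_cong[OF AB, of dim_col] by simp
    moreover have "dim_row B = n" using arg_cong[OF BA, of dim_col] S by simp
    ultimately show ?thesis using BA by auto
  qed
  then obtain B where B: "B * ?S = 1\<^sub>m n" "B \<in> carrier_mat n n"
    by blast
  ultimately have "B *\<^sub>v 0\<^sub>v n = vec n u"
    using assoc_mult_mat_vec[OF B(2) S, of "vec n u"] by simp
  moreover have "B *\<^sub>v 0\<^sub>v n = 0\<^sub>v n" using B(2) by auto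
  ultimately have "vec n u = 0\<^sub>v n" by simp
  then show "u k = 0" using k by (metis index_vec index_zero_vec(1))
qed

end

lemma basis_vpoly_const: "k < n \<Longrightarrow> m < n \<Longrightarrow> basis_vpoly n k $ m = [:if m = k then 1 else 0:]"
  by (simp add: basis_vpoly_def)

context matrix_distribution
begin

definition constant_vpoly :: "vpoly \<Rightarrow> (nat \<Rightarrow> complex) \<Rightarrow> bool" where
  "constant_vpoly f v \<longleftrightarrow> (\<forall>m<n. f $ m = [:v m:])"

text \<open>The premise under which T is claimed to be real. It is carried as an antecedent through
  the invariants below, so that one induction serves both the complex and the real claim.\<close>

definition real_mass :: bool where
  "real_mass \<longleftrightarrow> (\<forall>i<n. \<forall>j<n. matrix_moment n \<sigma> 0 $$ (i, j) \<in> \<real>)"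

lemma L2_inner_constant:
  assumes "constant_vpoly f v" "constant_vpoly g u"
  shows "L2_inner n \<sigma> f g = (\<Sum>i<n. \<Sum>j<n. cnj (v i) * u j * matrix_moment n \<sigma> 0 $$ (i, j))"
proof -
  have "L2_inner n \<sigma> f g = form (\<lambda>i t. v i) (\<lambda>i t. u i)"
    unfolding L2_inner_eq_form using assms by (intro form_cong) (simp_all add: constant_vpoly_def)
  then show ?thesis by (simp add: form_const matrix_moment_0)
qed

lemma L2_inner_constant_real:
  assumes "real_mass" "constant_vpoly f v" "constant_vpoly g u" "\<And>m. v m \<in> \<real>" "\<And>m. u m \<in> \<real>"
  shows "L2_inner n \<sigma> f g \<in> \<real>"
  unfolding L2_inner_constant[OF assms(2,3)]
  using assms by (intro sum_in_Reals Reals_mult) (auto simp: real_mass_def Reals_cnj_iff)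

text \<open>Only multiples of earlier constants are subtracted from e_k, and these vanish in
  component k and beyond. Component k therefore keeps the value 1, which later forces a nonzero
  norm.\<close>

lemma gs_residual_initial:
  assumes k: "k < n" and len: "length ps = k"
    and ps: "\<And>a. a < k \<Longrightarrow> constant_vpoly (ps ! a) (v a)" "\<And>a m. a < k \<Longrightarrow> a < m \<Longrightarrow> v a m = 0"
      "\<And>a m. a < k \<Longrightarrow> real_mass \<Longrightarrow> v a m \<in> \<real>"
  obtains u where "constant_vpoly (gs_residual n \<sigma> ps k) u" "\<And>m. k < m \<Longrightarrow> u m = 0" "u k = 1"
    "\<And>m. real_mass \<Longrightarrow> u m \<in> \<real>"
proof
  define c where "c a = L2_inner n \<sigma> (ps ! a) (basis_vpoly n k)" for a
  let ?u = "\<lambda>m. (if m = k then 1 else 0) - (\<Sum>a<k. c a * v a m)"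
  have sum: "(\<Sum>a<k. [:f a:]) = [:\<Sum>a<k. f a:]" for f :: "nat \<Rightarrow> complex"
    by (induction k) simp_all
  show "constant_vpoly (gs_residual n \<sigma> ps k) ?u"
    using k ps(1) by (simp add: constant_vpoly_def gs_residual_def basis_vpoly_const len c_def sum)
  show "?u m = 0" if "k < m" for m
    using that ps(2) by (simp add: order.strict_trans)
  show "?u k = 1" using ps(2) by simp
  show "?u m \<in> \<real>" if r: "real_mass" for m
  proof -
    have "c a \<in> \<real>" if "a < k" for a
      unfolding c_def
      by (rule L2_inner_constant_real[OF r ps(1)[OF that], of _ "\<lambda>m. if m = k then 1 else 0"])
        (use k ps(3)[OF that r] in \<open>auto simp: constant_vpoly_def basis_vpoly_const\<close>)
    then show ?thesis
      using ps(3) r by (auto intro!: Reals_diff sum_in_Reals Reals_mult)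
  qed
qed

text \<open>The vectors v a are the columns of an upper triangular matrix; for a list of length n
  its inverse is the T of the theorem.\<close>

definition initial :: "vpoly list \<Rightarrow> bool" where
  "initial ps \<longleftrightarrow> (\<exists>v. \<forall>a<length ps. constant_vpoly (ps ! a) (v a) \<and> (\<forall>m>a. v a m = 0) \<and>
     (real_mass \<longrightarrow> (\<forall>m. v a m \<in> \<real>)))"

lemma initial_residual:
  assumes inv: "invertible_mat (matrix_moment n \<sigma> 0)" and k: "length ps < n" and ps: "initial ps"
  defines "r \<equiv> gs_residual n \<sigma> ps (length ps)"
  shows "L2_norm n \<sigma> r \<noteq> 0"
    and "initial (ps @ [[:complex_of_real (1 / L2_norm n \<sigma> r):] \<cdot>\<^sub>v r])"
proof -
  obtain v where v: "\<And>a. a < length ps \<Longrightarrow> constant_vpoly (ps ! a) (v a)"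
    "\<And>a m. a < length ps \<Longrightarrow> a < m \<Longrightarrow> v a m = 0" "\<And>a m. a < length ps \<Longrightarrow> real_mass \<Longrightarrow> v a m \<in> \<real>"
    using ps unfolding initial_def by blast
  obtain u where u: "constant_vpoly r u" "\<And>m. length ps < m \<Longrightarrow> u m = 0" "u (length ps) = 1"
    "\<And>m. real_mass \<Longrightarrow> u m \<in> \<real>"
    using gs_residual_initial[of "length ps" ps v] k v unfolding r_def by blast
  show "L2_norm n \<sigma> r \<noteq> 0"
  proof
    assume z: "L2_norm n \<sigma> r = 0"
    have "null (\<lambda>i t. u i)"
      using L2_inner_self[of r] z u(1)
      by (simp add: null_def polynomial_fun_const L2_inner_constant form_const matrix_moment_0)
    then show False using null_const_eq_0[OF inv, of u "length ps"] k u(3) by simp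
  qed
  have "dim_vec r = n" by (simp add: r_def gs_residual_def)
  then have "constant_vpoly ([:complex_of_real (1 / L2_norm n \<sigma> r):] \<cdot>\<^sub>v r) (\<lambda>m. complex_of_real (1 / L2_norm n \<sigma> r) * u m)"
    using u(1) by (simp add: constant_vpoly_def)
  then show "initial (ps @ [[:complex_of_real (1 / L2_norm n \<sigma> r):] \<cdot>\<^sub>v r])"
    unfolding initial_def using v u
    by (intro exI[of _ "\<lambda>a. if a < length ps then v a else (\<lambda>m. complex_of_real (1 / L2_norm n \<sigma> r) * u m)"])
      (auto simp: nth_append less_Suc_eq intro!: Reals_mult)
qed

text \<open>As long as there is no zero-norm polynomial, no step is skipped. Up to n, the number of
  a step is therefore also the index of the polynomial it produces.\<close>

lemma gs_lists_initial:
  assumes inv: "invertible_mat (matrix_moment n \<sigma> 0)"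
  shows "k \<le> n \<Longrightarrow> snd (gs_lists n \<sigma> k) = [] \<and> length (fst (gs_lists n \<sigma> k)) = k \<and> initial (fst (gs_lists n \<sigma> k))"
proof (induction k)
  case 0
  show ?case by (simp add: initial_def)
next
  case (Suc k)
  obtain ps where g: "gs_lists n \<sigma> k = (ps, [])" "length ps = k" "initial ps"
    using Suc by (cases "gs_lists n \<sigma> k") auto
  then show ?case
    using initial_residual[OF inv, of ps] Suc.prems by (simp add: Let_def)
qed

text \<open>T is obtained without inverting a matrix: solving the residual formula for e_j gives e_j
  = norm (r j) p_j plus the sum of <p_i, e_j> p_i over i < j. The diagonal entries are the norms of
  the residuals, nonzero by \<open>initial_residual\<close>.\<close>

lemma upper_triangular_expansion:
  assumes inv: "invertible_mat (matrix_moment n \<sigma> 0)" and gs: "gram_schmidt_output n \<sigma> p j\<^sub>0 q"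
  obtains T :: "nat \<Rightarrow> nat \<Rightarrow> complex" where
    "\<And>i j. j < i \<Longrightarrow> T i j = 0" "\<And>j. j < n \<Longrightarrow> T j j \<in> \<real> \<and> T j j \<noteq> 0"
    "\<And>i j. real_mass \<Longrightarrow> i < n \<Longrightarrow> j < n \<Longrightarrow> T i j \<in> \<real>"
    "\<And>j m t. j < n \<Longrightarrow> m < n \<Longrightarrow> (if m = j then 1 else 0) = (\<Sum>i<n. T i j * eval_vpoly (p i) m t)"
proof
  define r where "r j = gs_residual n \<sigma> (fst (gs_lists n \<sigma> j)) j" for j
  let ?T = "\<lambda>i j. if i < j then L2_inner n \<sigma> (p i) (basis_vpoly n j)
    else if i = j then complex_of_real (L2_norm n \<sigma> (r j)) else 0"
  have step: "L2_norm n \<sigma> (r j) \<noteq> 0" "p j = [:complex_of_real (1 / L2_norm n \<sigma> (r j)):] \<cdot>\<^sub>v r j"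
    "\<And>i. i < j \<Longrightarrow> fst (gs_lists n \<sigma> j) ! i = p i" "length (fst (gs_lists n \<sigma> j)) = j"
    if "j < n" for j
  proof -
    obtain ps where g: "gs_lists n \<sigma> j = (ps, [])" "length ps = j" "initial ps"
      using gs_lists_initial[OF inv less_imp_le[OF \<open>j < n\<close>]] by (cases "gs_lists n \<sigma> j") auto
    then show nz: "L2_norm n \<sigma> (r j) \<noteq> 0"
      using initial_residual(1)[OF inv, of ps] that by (simp add: r_def)
    then have "fst (gs_lists n \<sigma> (Suc j)) = ps @ [[:complex_of_real (1 / L2_norm n \<sigma> (r j)):] \<cdot>\<^sub>v r j]"
      by (simp add: g r_def Let_def)
    then show "p j = [:complex_of_real (1 / L2_norm n \<sigma> (r j)):] \<cdot>\<^sub>v r j"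
      using gram_schmidt_output_nth[OF gs, of j "Suc j"] g(2) by (simp add: nth_append)
    show "fst (gs_lists n \<sigma> j) ! i = p i" if "i < j" for i
      using gram_schmidt_output_nth[OF gs, of i j] g that by simp
    show "length (fst (gs_lists n \<sigma> j)) = j" using g by simp
  qed
  show "?T i j = 0" if "j < i" for i j using that by simp
  show "?T j j \<in> \<real> \<and> ?T j j \<noteq> 0" if "j < n" for j using step(1)[OF that] by simp
  show "?T i j \<in> \<real>" if real: "real_mass" and "i < n" "j < n" for i j
  proof -
    have basis: "constant_vpoly (basis_vpoly n j) (\<lambda>m. if m = j then 1 else 0)"
      using \<open>j < n\<close> by (simp add: constant_vpoly_def basis_vpoly_const)
    have "L2_inner n \<sigma> (p i) (basis_vpoly n j) \<in> \<real>" if ij: "i < j"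
    proof -
      obtain v where "constant_vpoly (p i) v" "\<And>m. v m \<in> \<real>"
        using gs_lists_initial[OF inv less_imp_le[OF \<open>j < n\<close>]] step(3,4)[OF \<open>j < n\<close>] real ij
        unfolding initial_def by metis
      then show ?thesis
        by (intro L2_inner_constant_real[OF real _ basis]) auto
    qed
    then show ?thesis by simp
  qed
  show "(if m = j then 1 else 0) = (\<Sum>i<n. ?T i j * eval_vpoly (p i) m t)" if j: "j < n" and m: "m < n" for j m t
  proof -
    have dim: "dim_vec (r j) = n" by (simp add: r_def gs_residual_def)
    have "(\<Sum>i<n. ?T i j * eval_vpoly (p i) m t) = (\<Sum>i<Suc j. ?T i j * eval_vpoly (p i) m t)"
      using j by (intro sum.mono_neutral_right) auto
    also have "\<dots> = (\<Sum>i<j. L2_inner n \<sigma> (p i) (basis_vpoly n j) * eval_vpoly (p i) m t) +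
        complex_of_real (L2_norm n \<sigma> (r j)) * eval_vpoly (p j) m t"
      by simp
    also have "complex_of_real (L2_norm n \<sigma> (r j)) * eval_vpoly (p j) m t = eval_vpoly (r j) m t"
      using step(1)[OF j] m dim by (subst step(2)[OF j]) simp
    also have "\<dots> = (if m = j then 1 else 0) - (\<Sum>i<j. L2_inner n \<sigma> (p i) (basis_vpoly n j) * eval_vpoly (p i) m t)"
      unfolding r_def eval_gs_residual[OF m] using step(3,4)[OF j] j m
      by (simp add: basis_vpoly_const sum_negf)
    finally show ?thesis by simp
  qed
qed

end

section \<open>Recovering the matrix measure from the spectral function\<close>

lemma (in spectral_resolution) cinner_E_sum:
  "cinner (\<Sum>a\<in>S. u a *\<^sub>C x a) (E t (\<Sum>b\<in>R. v b *\<^sub>C y b)) =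
    (\<Sum>a\<in>S. \<Sum>b\<in>R. cnj (u a) * v b * cinner (x a) (E t (y b)))"
proof -
  have "cinner (x a) (E t (\<Sum>b\<in>R. v b *\<^sub>C y b)) = (\<Sum>b\<in>R. v b * cinner (x a) (E t (y b)))" for a
    by (simp add: E_symmetric[symmetric] cinner_sum_right cinner_scaleC_right)
  then show ?thesis
    by (simp add: cinner_sum_left cinner_scaleC_left sum_distrib_left mult.assoc)
qed

section \<open>Transfer of multiplication by z to the operator\<close>

context matrix_distribution
begin

text \<open>
  The graph of the isometry from the vector polynomials modulo null polynomials onto the span of
  \<open>\<delta>\<close> which maps \<open>p i\<close> to \<open>\<delta> i\<close>.
\<close>

definition represents ::
  "(nat \<Rightarrow> vpoly) \<Rightarrow> (nat \<Rightarrow> 'h) \<Rightarrow> (nat \<Rightarrow> real \<Rightarrow> complex) \<Rightarrow> 'h :: complex_hilbert \<Rightarrow> bool" where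
  "represents p \<delta> f x \<longleftrightarrow> (\<exists>N a h. null h \<and>
     (\<forall>m<n. \<forall>t. f m t = (\<Sum>i<N. a i * eval_vpoly (p i) m t) + h m t) \<and> x = (\<Sum>i<N. a i *\<^sub>C \<delta> i))"

text \<open>Null parts pair to zero with every polynomial function, and on what remains the Gram
  matrices of p and \<delta> agree.\<close>

lemma represents_inner:
  assumes gs: "gram_schmidt_output n \<sigma> p j\<^sub>0 q"
    and \<delta>: "\<And>k l. cinner (\<delta> k) (\<delta> l) = (if k = l then 1 else 0)"
    and f: "represents p \<delta> f x" and g: "represents p \<delta> g y"
  shows "form f g = cinner x y"
proof -
  obtain N a h where f: "null h" "\<And>m t. m < n \<Longrightarrow> f m t = (\<Sum>i<N. a i * eval_vpoly (p i) m t) + h m t"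
    "x = (\<Sum>i<N. a i *\<^sub>C \<delta> i)"
    using f unfolding represents_def by blast
  obtain M b k where g: "null k" "\<And>m t. m < n \<Longrightarrow> g m t = (\<Sum>i<M. b i * eval_vpoly (p i) m t) + k m t"
    "y = (\<Sum>i<M. b i *\<^sub>C \<delta> i)"
    using g unfolding represents_def by blast
  let ?f = "\<lambda>m t. \<Sum>i<N. a i * eval_vpoly (p i) m t"
  let ?g = "\<lambda>m t. \<Sum>i<M. b i * eval_vpoly (p i) m t"
  have poly: "polynomial_fun (?f m)" "polynomial_fun (?g m)" "m < n \<Longrightarrow> polynomial_fun (h m)"
    "m < n \<Longrightarrow> polynomial_fun (k m)" for m
    using f(1) g(1) by (auto simp: null_def intro!: polynomial_fun_intros)
  have "form f g = form (\<lambda>m t. ?f m t + h m t) (\<lambda>m t. ?g m t + k m t)"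
    by (rule form_cong) (simp_all add: f g)
  also have "\<dots> = form ?f (\<lambda>m t. ?g m t + k m t) + form h (\<lambda>m t. ?g m t + k m t)"
    by (intro form_add_left poly polynomial_fun_add)
  also have "form h (\<lambda>m t. ?g m t + k m t) = 0"
    by (intro null_form[OF f(1)] poly polynomial_fun_add)
  also have "form ?f (\<lambda>m t. ?g m t + k m t) = form ?f ?g + form ?f k"
    by (intro form_add_right poly)
  also have "form ?f k = 0"
    by (intro null_form[OF g(1)] poly)
  also have "form ?f ?g = (\<Sum>i<N. cnj (a i) * (\<Sum>j<M. b j * form (eval_vpoly (p i)) (eval_vpoly (p j))))"
    by (subst form_sum_left, (intro poly polynomial_fun_poly)+, subst form_sum_right) (intro polynomial_fun_poly refl)+
  also have "\<dots> = (\<Sum>i<N. cnj (a i) * (\<Sum>j<M. b j * cinner (\<delta> i) (\<delta> j)))"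
    using gram_schmidt_output_orthonormal[OF gs] unfolding L2_inner_eq_form by (simp only: \<delta>)
  also have "\<dots> = (\<Sum>i<N. cnj (a i) * cinner (\<delta> i) y)"
    unfolding g(3) by (simp only: cinner_sum_right cinner_scaleC_right)
  also have "\<dots> = cinner x y"
    unfolding f(3) by (simp only: cinner_sum_left cinner_scaleC_left)
  finally show ?thesis by simp
qed

text \<open>If f has coefficients a, then z f has the coefficients b i = sum of c i l * a l over l,
  the image of a under the matrix. All terms containing some q j, and z h, are collected in the null
  part.\<close>

lemma represents_shift:
  assumes gs: "gram_schmidt_output n \<sigma> p j\<^sub>0 q"
    and c: "\<And>k. \<exists>l (R :: nat \<Rightarrow> complex poly). (\<forall>i\<ge>l. c i k = 0) \<and>
           (\<forall>m<n. [:0, 1:] * vec_index (p k) m =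
              (\<Sum>i<l. smult (c i k) (vec_index (p i) m)) + (\<Sum>j<j\<^sub>0. R j * vec_index (q j) m))"
    and A: "\<And>N a. (\<Sum>l<N. a l *\<^sub>C \<delta> l, \<Sum>l<N. a l *\<^sub>C (\<Sum>k. c k l *\<^sub>C \<delta> k)) \<in> A"
    and f: "represents p \<delta> f x"
  shows "\<exists>y. (x, y) \<in> A \<and> represents p \<delta> (\<lambda>m t. complex_of_real t * f m t) y"
proof -
  have "\<forall>k. \<exists>l (R :: nat \<Rightarrow> complex poly). (\<forall>i\<ge>l. c i k = 0) \<and>
           (\<forall>m<n. [:0, 1:] * vec_index (p k) m =
              (\<Sum>i<l. smult (c i k) (vec_index (p i) m)) + (\<Sum>j<j\<^sub>0. R j * vec_index (q j) m))"
    by (intro allI c)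
  then obtain L R where LR: "\<forall>k. (\<forall>i\<ge>L k. c i k = 0) \<and>
      (\<forall>m<n. [:0, 1:] * vec_index (p k) m =
         (\<Sum>i<L k. smult (c i k) (vec_index (p i) m)) + (\<Sum>j<j\<^sub>0. (R k j :: complex poly) * vec_index (q j) m))"
    by (elim choice[THEN exE]) (rule that)
  have L: "c i k = 0" if "L k \<le> i" for i k
    using LR that by blast
  have R: "[:0, 1:] * vec_index (p k) m =
      (\<Sum>i<L k. smult (c i k) (vec_index (p i) m)) + (\<Sum>j<j\<^sub>0. R k j * vec_index (q j) m)" if "m < n" for k m
    using LR that by blast
  obtain N a h where f: "null h" "\<And>m t. m < n \<Longrightarrow> f m t = (\<Sum>i<N. a i * eval_vpoly (p i) m t) + h m t"
    "x = (\<Sum>i<N. a i *\<^sub>C \<delta> i)"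
    using f unfolding represents_def by blast
  \<comment> \<open>A common bound for the finitely many columns involved; the inserted 0 keeps the
    maximum defined for N = 0.\<close>
  define K where "K = Max (insert 0 (L ` {..<N}))"
  have K: "L l \<le> K" if "l < N" for l
    unfolding K_def using that by (intro Max_ge) auto
  define b where "b i = (\<Sum>l<N. a l * c i l)" for i
  let ?y = "\<Sum>i<K. b i *\<^sub>C \<delta> i"
  let ?k = "\<lambda>m t. (\<Sum>l<N. a l * (\<Sum>j<j\<^sub>0. poly (R l j) (complex_of_real t) * eval_vpoly (q j) m t)) + complex_of_real t * h m t"
  have "null ?k"
    by (intro null_add null_sum null_mult polynomial_fun_of_real polynomial_fun_const polynomial_fun_poly
        gram_schmidt_output_null[OF gs] f(1)) auto
  moreover have "complex_of_real t * f m t = (\<Sum>i<K. b i * eval_vpoly (p i) m t) + ?k m t" if m: "m < n" for m t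
  proof -
    have z: "complex_of_real t * eval_vpoly (p l) m t = (\<Sum>i<K. c i l * eval_vpoly (p i) m t) +
        (\<Sum>j<j\<^sub>0. poly (R l j) (complex_of_real t) * eval_vpoly (q j) m t)" if l: "l < N" for l
    proof -
      have "complex_of_real t * eval_vpoly (p l) m t = (\<Sum>i<L l. c i l * eval_vpoly (p i) m t) +
        (\<Sum>j<j\<^sub>0. poly (R l j) (complex_of_real t) * eval_vpoly (q j) m t)"
        using arg_cong[OF R[OF m, of l], of "\<lambda>r. poly r (complex_of_real t)"] by (simp add: poly_sum)
      also have "(\<Sum>i<L l. c i l * eval_vpoly (p i) m t) = (\<Sum>i<K. c i l * eval_vpoly (p i) m t)"
        using K[OF l] L by (intro sum.mono_neutral_left) auto
      finally show ?thesis .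
    qed
    have "complex_of_real t * f m t = (\<Sum>l<N. a l * (complex_of_real t * eval_vpoly (p l) m t)) + complex_of_real t * h m t"
      by (simp add: f(2)[OF m] sum_distrib_left distrib_left mult_ac)
    also have "(\<Sum>l<N. a l * (complex_of_real t * eval_vpoly (p l) m t)) =
        (\<Sum>l<N. \<Sum>i<K. a l * c i l * eval_vpoly (p i) m t) +
        (\<Sum>l<N. a l * (\<Sum>j<j\<^sub>0. poly (R l j) (complex_of_real t) * eval_vpoly (q j) m t))"
      by (simp add: z distrib_left sum.distrib sum_distrib_left mult.assoc)
    also have "(\<Sum>l<N. \<Sum>i<K. a l * c i l * eval_vpoly (p i) m t) = (\<Sum>i<K. b i * eval_vpoly (p i) m t)"
      unfolding b_def sum_distrib_right by (rule sum.swap)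
    finally show ?thesis by (simp add: add.assoc)
  qed
  ultimately have "represents p \<delta> (\<lambda>m t. complex_of_real t * f m t) ?y"
    unfolding represents_def by blast
  moreover have "(\<Sum>l<N. a l *\<^sub>C (\<Sum>k. c k l *\<^sub>C \<delta> k)) = ?y"
  proof -
    have "(\<Sum>k. c k l *\<^sub>C \<delta> k) = (\<Sum>k<K. c k l *\<^sub>C \<delta> k)" if "l < N" for l
      using K[OF that] L by (intro suminf_finite) (auto simp: scaleC_zero_left)
    then have "(\<Sum>l<N. a l *\<^sub>C (\<Sum>k. c k l *\<^sub>C \<delta> k)) = (\<Sum>l<N. \<Sum>k<K. (a l * c k l) *\<^sub>C \<delta> k)"
      by (simp add: scaleC_sum_right scaleC_scaleC)
    also have "\<dots> = ?y"
      unfolding b_def scaleC_sum_left by (rule sum.swap)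
    finally show ?thesis .
  qed
  ultimately show ?thesis using A[of a N] f(3) by auto
qed

lemma represents_powers:
  assumes gs: "gram_schmidt_output n \<sigma> p j\<^sub>0 q"
    and c: "\<And>k. \<exists>l (R :: nat \<Rightarrow> complex poly). (\<forall>i\<ge>l. c i k = 0) \<and>
           (\<forall>m<n. [:0, 1:] * vec_index (p k) m =
              (\<Sum>i<l. smult (c i k) (vec_index (p i) m)) + (\<Sum>j<j\<^sub>0. R j * vec_index (q j) m))"
    and A: "\<And>N a. (\<Sum>l<N. a l *\<^sub>C \<delta> l, \<Sum>l<N. a l *\<^sub>C (\<Sum>k. c k l *\<^sub>C \<delta> k)) \<in> A"
    and f: "represents p \<delta> f x"
  shows "\<exists>y. y 0 = x \<and> (\<forall>k. (y k, y (Suc k)) \<in> A \<and> represents p \<delta> (\<lambda>m t. complex_of_real t ^ k * f m t) (y k))"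
proof -
  \<comment> \<open>A is a graph and \<open>represents_shift\<close> gives mere existence, so the
    chain arises by dependent choice; the clause for k = 0 pins its start to x.\<close>
  define Y where "Y k y \<longleftrightarrow> (k = 0 \<longrightarrow> y = x) \<and> represents p \<delta> (\<lambda>m t. complex_of_real t ^ k * f m t) y" for k y
  have "\<exists>y. \<forall>k. Y k (y k) \<and> (y k, y (Suc k)) \<in> A"
  proof (rule dependent_nat_choice)
    show "\<exists>y. Y 0 y" using f by (auto simp: Y_def)
    fix y k assume "Y k y"
    then show "\<exists>z. Y (Suc k) z \<and> (y, z) \<in> A"
      using represents_shift[OF gs c A, of "\<lambda>m t. complex_of_real t ^ k * f m t" y]
      by (auto simp: Y_def mult.assoc)
  qed
  then show ?thesis unfolding Y_def by blast
qed

lemma form_unit: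
  assumes "i < n" "j < n"
  shows "form (\<lambda>m t. if m = i then 1 else 0) (\<lambda>m t. r t * (if m = j then 1 else 0)) = entry_integral i j r"
proof -
  have zero: "entry_integral a b (\<lambda>t. 0) = 0" for a b
    using entry_integral_cmult[of a b 0 "\<lambda>t. 0"] by simp
  have "entry_integral a b (\<lambda>t. cnj (if a = i then 1 else 0) * (r t * (if b = j then 1 else 0))) =
      (if b = j then if a = i then entry_integral a b r else 0 else 0)" for a b
    by (simp add: zero)
  then show ?thesis using assms by (simp add: form_def)
qed

end

theorem theorem5p2:
  fixes n :: nat
    and \<sigma>' :: "real \<Rightarrow> complex mat"
    and p q :: "nat \<Rightarrow> complex poly vec"
    and j\<^sub>0 :: nat
    and c :: "nat \<Rightarrow> nat \<Rightarrow> complex"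
    and \<delta> :: "nat \<Rightarrow> 'h::complex_hilbert"
    and A :: "('h \<times> 'h) set"
    and E :: "real \<Rightarrow> 'h \<Rightarrow> 'h"
    and \<sigma> :: "real \<Rightarrow> complex mat"
  assumes "n \<ge> 1"
    and "\<sigma>' \<in> \<MM>\<^sub>d n"
    and "gram_schmidt_output n \<sigma>' p j\<^sub>0 q"
    and "\<And>k. \<exists>l (R :: nat \<Rightarrow> complex poly). (\<forall>i\<ge>l. c i k = 0) \<and>
           (\<forall>m<n. [:0, 1:] * vec_index (p k) m =
              (\<Sum>i<l. smult (c i k) (vec_index (p i) m)) + (\<Sum>j<j\<^sub>0. R j * vec_index (q j) m))"
    and "orthonormal_basis \<delta>"
    and "A = minimal_closed_operator c \<delta>"
    and "self_adjoint A"
    and "resolution_of_identity_of E A"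
    and "\<sigma> = spectral_function n \<delta> E"
  shows "\<exists>T \<in> carrier_mat n n. upper_triangular T \<and>
           (\<forall>i<n. T $$ (i, i) \<in> \<real> \<and> T $$ (i, i) \<noteq> 0) \<and>
           ((\<forall>i<n. \<forall>j<n. matrix_moment n \<sigma>' 0 $$ (i, j) \<in> \<real>) \<longrightarrow>
              (\<forall>i<n. \<forall>j<n. T $$ (i, j) \<in> \<real>)) \<and>
           (\<forall>t. mat_adjoint T * \<sigma> t * T = \<sigma>' t)"
proof -
  note gs = assms(3) and c = assms(4) and sa = assms(7)
  interpret matrix_distribution n \<sigma>'
    using assms(2) by unfold_locales (auto simp: \<MM>\<^sub>d_def \<MM>_def)
  have inv: "invertible_mat (matrix_moment n \<sigma>' 0)"
    using assms(2) by (simp add: \<MM>\<^sub>d_def \<MM>_def)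
  have AE: "A = spectral_operator E" and res: "resolution_of_identity E"
    using assms(8) by (simp_all add: resolution_of_identity_of_def)
  interpret selfadjoint_resolution E
    using sa AE res by unfold_locales (simp_all add: self_adjoint_def)
  have \<delta>: "cinner (\<delta> k) (\<delta> l) = (if k = l then 1 else 0)" for k l
    using assms(5) by (simp add: orthonormal_basis_def)
  have A: "(\<Sum>l<N. a l *\<^sub>C \<delta> l, \<Sum>l<N. a l *\<^sub>C (\<Sum>k. c k l *\<^sub>C \<delta> k)) \<in> A" for N a
    unfolding assms(6) minimal_closed_operator_def by (rule subsetD[OF closure_subset]) blast
  obtain T where T: "\<And>i j. j < i \<Longrightarrow> T i j = 0" "\<And>j. j < n \<Longrightarrow> T j j \<in> \<real> \<and> T j j \<noteq> 0"
    "\<And>i j. real_mass \<Longrightarrow> i < n \<Longrightarrow> j < n \<Longrightarrow> T i j \<in> \<real>"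
    "\<And>j m t. j < n \<Longrightarrow> m < n \<Longrightarrow> (if m = j then 1 else 0) = (\<Sum>i<n. T i j * eval_vpoly (p i) m t)"
    by (rule upper_triangular_expansion[OF inv gs]) (rule that)
  define X where "X j = (\<Sum>i<n. T i j *\<^sub>C \<delta> i)" for j
  have "represents p \<delta> (\<lambda>m t. if m = j then 1 else 0) (X j)" if "j < n" for j
    unfolding represents_def X_def using T(4)[OF that] null_zero
    by (intro exI[of _ n] exI[of _ "\<lambda>i. T i j"] exI[of _ "\<lambda>m t. 0"]) simp
  then have "\<exists>y. y 0 = X j \<and> (\<forall>k. (y k, y (Suc k)) \<in> A \<and>
      represents p \<delta> (\<lambda>m t. complex_of_real t ^ k * (if m = j then 1 else 0)) (y k))" if "j < n" for j
    using that by (intro represents_powers[OF gs c A])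
  then have "\<forall>j. \<exists>y. j < n \<longrightarrow> y 0 = X j \<and> (\<forall>k. (y k, y (Suc k)) \<in> A \<and>
      represents p \<delta> (\<lambda>m t. complex_of_real t ^ k * (if m = j then 1 else 0)) (y k))"
    by blast
  then obtain x where "\<forall>j. j < n \<longrightarrow> x j 0 = X j \<and> (\<forall>k. (x j k, x j (Suc k)) \<in> A \<and>
      represents p \<delta> (\<lambda>m t. complex_of_real t ^ k * (if m = j then 1 else 0)) (x j k))"
    by (elim choice[THEN exE]) (rule that)
  then have x: "\<And>j. j < n \<Longrightarrow> x j 0 = X j" "\<And>j k. j < n \<Longrightarrow> (x j k, x j (Suc k)) \<in> A"
    "\<And>j k. j < n \<Longrightarrow> represents p \<delta> (\<lambda>m t. complex_of_real t ^ k * (if m = j then 1 else 0)) (x j k)"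
    by blast+
  have moment: "has_stieltjes_integral (\<lambda>t. complex_of_real (t ^ k)) (\<lambda>t. cinner (X i) (E t (X j)))
      (matrix_moment n \<sigma>' k $$ (i, j))" if ij: "i < n" "j < n" for i j k
  proof -
    have "form (\<lambda>m t. if m = i then 1 else 0) (\<lambda>m t. complex_of_real t ^ k * (if m = j then 1 else 0)) =
        cinner (X i) (x j k)"
      using x(3)[OF ij(1), of 0] x(3)[OF ij(2), of k] x(1)[OF ij(1)]
      by (intro represents_inner[OF gs \<delta>]) simp_all
    then have "matrix_moment n \<sigma>' k $$ (i, j) = cinner (X i) (x j k)"
      using ij by (simp add: matrix_moment_def stieltjes_integral_entry polynomial_fun_power form_unit)
    then show ?thesis
      using spectral_moment[of "x j" "x i" k] x(1,2) ij by (simp add: AE)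
  qed
  define T' where "T' = mat n n (\<lambda>(i, j). T i j)"
  define \<tau> where "\<tau> t = mat_adjoint T' * \<sigma> t * T'" for t
  have \<tau>_carrier: "\<tau> t \<in> carrier_mat n n" for t
    by (simp add: \<tau>_def T'_def mat_adjoint_def carrier_matI)
  have \<tau>: "\<tau> t $$ (i, j) = cinner (X i) (E t (X j))" if ij: "i < n" "j < n" for t i j
  proof -
    have adj: "mat_adjoint T' = mat n n (\<lambda>(i, a). cnj (T a i))"
      by (rule eq_matI) (simp_all add: mat_adjoint_def T'_def mat_of_rows_def)
    have "\<tau> t $$ (i, j) = (\<Sum>b<n. (\<Sum>a<n. cnj (T a i) * cinner (\<delta> a) (E t (\<delta> b))) * T b j)"
      unfolding \<tau>_def adj using ij by (simp add: T'_def assms(9) spectral_function_def scalar_prod_def lessThan_atLeast0)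
    also have "\<dots> = (\<Sum>a<n. \<Sum>b<n. cnj (T a i) * T b j * cinner (\<delta> a) (E t (\<delta> b)))"
      unfolding sum_distrib_right by (subst sum.swap) (simp add: mult_ac)
    finally show ?thesis by (simp add: X_def cinner_E_sum)
  qed
  have "nondecreasing_matrix_function n \<tau>"
    unfolding nondecreasing_matrix_function_def
  proof (intro conjI allI impI)
    fix s t :: real assume st: "s \<le> t"
    show "positive_semidefinite n (\<tau> t - \<tau> s)"
      unfolding positive_semidefinite_def
    proof (intro conjI ballI)
      show car: "\<tau> t - \<tau> s \<in> carrier_mat n n" by (intro minus_carrier_mat \<tau>_carrier)
      fix v :: "complex vec" assume "v \<in> carrier_vec n"
      then have v: "v = vec n (($) v)" by auto
      \<comment> \<open>Because the entries of \<tau> are <X i, E t (X j)>, the quadratic form of an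
        increment of \<tau> at v is the increment of \<open>weight\<close> at this single
        vector.\<close>
      let ?w = "\<Sum>j<n. v $ j *\<^sub>C X j"
      have "((\<tau> t - \<tau> s) *\<^sub>v v) \<bullet>c v = (\<Sum>i<n. \<Sum>j<n. cnj (v $ i) * v $ j * (\<tau> t - \<tau> s) $$ (i, j))"
        using cscalar_prod_mult_mat_vec[OF car, of "($) v"] v by metis
      also have "\<dots> = cinner ?w (E t ?w) - cinner ?w (E s ?w)"
        unfolding cinner_E_sum sum_subtractf[symmetric]
        by (intro sum.cong refl) (simp add: \<tau> carrier_matD[OF \<tau>_carrier] right_diff_distrib)
      also have "\<dots> = complex_of_real (weight ?w t - weight ?w s)"
        by (simp add: cinner_E_self)
      finally have eq: "((\<tau> t - \<tau> s) *\<^sub>v v) \<bullet>c v = complex_of_real (weight ?w t - weight ?w s)" .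
      show "((\<tau> t - \<tau> s) *\<^sub>v v) \<bullet>c v \<in> \<real>" unfolding eq by (rule Reals_of_real)
      show "0 \<le> Re (((\<tau> t - \<tau> s) *\<^sub>v v) \<bullet>c v)" unfolding eq using weight_mono[OF st] by simp
    qed
  qed (simp_all add: \<tau>_carrier \<tau> cinner_E_right_continuous cinner_E_at_bot)
  moreover have "all_moments_exist n \<tau>"
    unfolding all_moments_exist_def using moment by (auto simp: \<tau>)
  moreover have "matrix_moment n \<tau> k = matrix_moment n \<sigma>' k" for k
  proof (rule eq_matI)
    fix i j assume "i < dim_row (matrix_moment n \<sigma>' k)" "j < dim_col (matrix_moment n \<sigma>' k)"
    then have ij: "i < n" "j < n" by (simp_all add: matrix_moment_def)
    then show "matrix_moment n \<tau> k $$ (i, j) = matrix_moment n \<sigma>' k $$ (i, j)"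
      \<comment> \<open>The moment of \<sigma>' is rewritten as the Stieltjes integral against <X i,
        E t (X j)>, which is the entry of \<tau>.\<close>
      unfolding stieltjes_integral_eqI[OF moment[OF ij, of k], symmetric]
      by (simp add: matrix_moment_def \<tau>)
  qed (simp_all add: matrix_moment_def)
  ultimately have "\<tau> = \<sigma>'"
    using assms(2) unfolding \<MM>\<^sub>d_def by blast
  then have "\<forall>t. mat_adjoint T' * \<sigma> t * T' = \<sigma>' t"
    by (simp flip: \<tau>_def)
  moreover have "T' \<in> carrier_mat n n" "upper_triangular T'"
    using T(1) by (auto simp: T'_def)
  moreover have "\<forall>i<n. T' $$ (i, i) \<in> \<real> \<and> T' $$ (i, i) \<noteq> 0"
    using T(2) by (simp add: T'_def)
  moreover have "(\<forall>i<n. \<forall>j<n. matrix_moment n \<sigma>' 0 $$ (i, j) \<in> \<real>) \<longrightarrow> (\<forall>i<n. \<forall>j<n. T' $$ (i, j) \<in> \<real>)"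
    using T(3) by (simp add: T'_def real_mass_def)
  ultimately show ?thesis by blast
qed

end
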